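(* Let $n\ge2$ and fix positive coset-depending weights $w_i:S_{-i}\to(0,\infty)$, $i=1,\dots,n$. Then, identifying the set $\mathcal{G}$ of finite games with $n$ players and $|S_i|=k_i$ with $\mathbb{R}^{nk}$, there is an orthogonal decomposition $$\mathcal{G}=\mathcal{P}^{cw}\oplus\mathcal{N}\oplus\mathcal{H}^{cw}$$ (the three subspaces are pairwise orthogonal for the standard inner product and their sum is $\mathcal{G}$), in which $\mathcal{P}^{cw}\oplus\mathcal{N}=\mathcal{G}_P^{cw}$ is the subspace of coset weighted potential games with weights $w_i(s_{-i})$, and $\mathcal{N}\oplus\mathcal{H}^{cw}$ is the subspace of coset weighted harmonic games.
   Context: A finite normal form game $G$ has players $N=\{1,\dots,n\}$, strategy sets $S_i=\{1,\dots,k_i\}$ with $k_i\ge2$, $S=\prod_i S_i$, $S_{-i}=\prod_{j\ne i}S_j$, payoffs $c_i:S\to\mathbb{R}$. Put $k=\prod_j k_j$. Let $\delta_m^j$ be the $j$-th column of $I_m$; for a profile $s$ put $x_j=\delta_{k_j}^{s_j}$. The structure vector of $c_i$ is the row vector $V_i^c\in\mathbb{R}^k$ with $c_i(s)=V_i^c(x_1\otimes\cdots\otimes x_n)$, and $V_G=[V_1^c,\dots,V_n^c]$; $G$ is identified with $V_G^T\in\mathbb{R}^{nk}$. The row vector $V_i^w\in\mathbb{R}^{k/k_i}$ is defined by $w_i(s_{-i})=V_i^w\,\bigotimes_{j\ne i}x_j$ (factors in increasing order of $j$). $E_i:=I_{k_1\cdots k_{i-1}}\otimes\mathbf{1}_{k_i}\otimes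 I_{k_{i+1}\cdots k_n}$ ($\mathbf{1}_m$ the all-ones column, empty products are $1$), and $\Lambda_i$ is the $k\times k$ diagonal matrix whose diagonal entries are the entries of $V_i^wE_i^T\in\mathbb{R}^k$. Subspaces (Span means column span): $\mathcal{P}^{cw}=\mathrm{Span}(B_{cw}^P)$, where $B_{cw}^P\in\mathbb{R}^{nk\times k}$ is the vertical stack of the blocks $\Lambda_i-\frac1{k_i}\Lambda_iE_iE_i^T$, $i=1,\dots,n$ (coset weighted pure potential games); $\mathcal{N}=\mathrm{Span}(B^N)$, where $B^N$ is the block diagonal matrix with diagonal blocks $E_1,\dots,E_n$ (non-strategic games, i.e. $c_i(x,s_{-i})=c_i(y,s_{-i})$ for all $i,x,y,s_{-i}$); $\mathcal{G}_P^{cw}$ is the set of all $V_G^T$ for which there is $P:S\to\mathbb{R}$ with $c_i(x,s_{-i})-c_i(y,s_{-i})=w_i(s_{-i})(P(x,s_{-i})-P(y,s_{-i}))$ for all $i\in N$, $x,y\in S_i$, $s_{-i}\in S_{-i}$; $\mathcal{H}^{cw}$ (coset weighted pure harmonic games) is the orthogonal complement of $\mathcal{G}_P^{cw}$ in $\mathbb{R}^{nk}$. By definition the subspace of coset weighted harmonic games is $\mathcal{N}\oplus\mathcal{H}^{cw}$. *)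

theory Defs
  imports Jordan_Normal_Form.VS_Connect "HOL-Library.FuncSet"
begin

section \<open>Kronecker products\<close>

definition kron_vec :: "real vec \<Rightarrow> real vec \<Rightarrow> real vec" where
  "kron_vec u v = vec (dim_vec u * dim_vec v) (\<lambda>p. u $ (p div dim_vec v) * v $ (p mod dim_vec v))"

definition kron_mat :: "real mat \<Rightarrow> real mat \<Rightarrow> real mat" where
  "kron_mat A B = mat (dim_row A * dim_row B) (dim_col A * dim_col B)
     (\<lambda>(p, q). A $$ (p div dim_row B, q div dim_col B) * B $$ (p mod dim_row B, q mod dim_col B))"

section \<open>Profiles and structure vectors\<close>

text \<open>
  The players are \<open>1, \<dots>, n\<close> and the strategies of player \<open>j\<close> are \<open>1, \<dots>, k j\<close>.
  A partial profile of the set \<open>J\<close> of players is an extensional function on \<open>J\<close>, so that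
  \<open>S = profiles k {1..n}\<close>, \<open>S\<^bsub>-i\<^esub> = profiles k ({1..n} - {i})\<close>, and the profile
  \<open>(x, s\<^bsub>-i\<^esub>)\<close> is \<open>s(i := x)\<close> for \<open>s \<in> S\<^bsub>-i\<^esub>\<close>.
\<close>

definition profiles :: "(nat \<Rightarrow> nat) \<Rightarrow> nat set \<Rightarrow> (nat \<Rightarrow> nat) set" where
  "profiles k J = (\<Pi>\<^sub>E j\<in>J. {1..k j})"

text \<open>
  The product of the columns \<open>x\<^sub>j\<close> over \<open>j \<in> J\<close>, in increasing order of \<open>j\<close>. Vectors are
  indexed from 0, so \<open>unit_vec m (l - 1)\<close> is column number \<open>l\<close> of the identity matrix.
\<close>

definition profile_vec :: "(nat \<Rightarrow> nat) \<Rightarrow> nat set \<Rightarrow> (nat \<Rightarrow> nat) \<Rightarrow> real vec" where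
  "profile_vec k J s =
     foldr kron_vec (map (\<lambda>j. unit_vec (k j) (s j - 1)) (sorted_list_of_set J)) (unit_vec 1 0)"

definition is_structure_vec ::
    "(nat \<Rightarrow> nat) \<Rightarrow> nat set \<Rightarrow> ((nat \<Rightarrow> nat) \<Rightarrow> real) \<Rightarrow> real vec \<Rightarrow> bool" where
  "is_structure_vec k J f V \<longleftrightarrow>
     V \<in> carrier_vec (\<Prod>j\<in>J. k j) \<and> (\<forall>s\<in>profiles k J. f s = V \<bullet> profile_vec k J s)"

text \<open>\<open>THE\<close> is justified by \<open>ex1_structure_vec\<close> below. Row vectors are represented by
  plain (orientation-free) vectors.\<close>

definition structure_vec :: "(nat \<Rightarrow> nat) \<Rightarrow> nat set \<Rightarrow> ((nat \<Rightarrow> nat) \<Rightarrow> real) \<Rightarrow> real vec" where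
  "structure_vec k J f = (THE V. is_structure_vec k J f V)"

definition game_vec :: "nat \<Rightarrow> (nat \<Rightarrow> nat) \<Rightarrow> (nat \<Rightarrow> (nat \<Rightarrow> nat) \<Rightarrow> real) \<Rightarrow> real vec" where
  "game_vec n k c = foldr (@\<^sub>v) (map (\<lambda>i. structure_vec k {1..n} (c i)) [1..<n+1]) vNil"

definition game_dim :: "nat \<Rightarrow> (nat \<Rightarrow> nat) \<Rightarrow> nat" where
  "game_dim n k = n * (\<Prod>j\<in>{1..n}. k j)"

section \<open>The subspaces\<close>

definition E_mat :: "nat \<Rightarrow> (nat \<Rightarrow> nat) \<Rightarrow> nat \<Rightarrow> real mat" where
  "E_mat n k i = kron_mat (kron_mat (1\<^sub>m (\<Prod>j\<in>{1..<i}. k j)) (mat (k i) 1 (\<lambda>_. 1)))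
                          (1\<^sub>m (\<Prod>j\<in>{i<..n}. k j))"

text \<open>The row vector \<open>V E\<^sup>T\<close> is the (transposed) vector \<open>E V\<^sup>T\<close>.\<close>

definition Lambda_mat ::
    "nat \<Rightarrow> (nat \<Rightarrow> nat) \<Rightarrow> (nat \<Rightarrow> (nat \<Rightarrow> nat) \<Rightarrow> real) \<Rightarrow> nat \<Rightarrow> real mat" where
  "Lambda_mat n k w i = mat_diag (\<Prod>j\<in>{1..n}. k j)
     (\<lambda>p. (E_mat n k i *\<^sub>v structure_vec k ({1..n} - {i}) (w i)) $ p)"

definition B_cw_P ::
    "nat \<Rightarrow> (nat \<Rightarrow> nat) \<Rightarrow> (nat \<Rightarrow> (nat \<Rightarrow> nat) \<Rightarrow> real) \<Rightarrow> real mat" where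
  "B_cw_P n k w = foldr (@\<^sub>r)
     (map (\<lambda>i. Lambda_mat n k w i
               - (1 / real (k i)) \<cdot>\<^sub>m (Lambda_mat n k w i * E_mat n k i * (E_mat n k i)\<^sup>T)) [1..<n+1])
     (0\<^sub>m 0 (\<Prod>j\<in>{1..n}. k j))"

definition B_N :: "nat \<Rightarrow> (nat \<Rightarrow> nat) \<Rightarrow> real mat" where
  "B_N n k = diag_block_mat (map (E_mat n k) [1..<n+1])"

definition pure_potential_games ::
    "nat \<Rightarrow> (nat \<Rightarrow> nat) \<Rightarrow> (nat \<Rightarrow> (nat \<Rightarrow> nat) \<Rightarrow> real) \<Rightarrow> real vec set" where
  "pure_potential_games n k w = vec_space.col_space (game_dim n k) (B_cw_P n k w)"

definition nonstrategic_games :: "nat \<Rightarrow> (nat \<Rightarrow> nat) \<Rightarrow> real vec set" where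
  "nonstrategic_games n k = vec_space.col_space (game_dim n k) (B_N n k)"

definition is_weighted_potential ::
    "nat \<Rightarrow> (nat \<Rightarrow> nat) \<Rightarrow> (nat \<Rightarrow> (nat \<Rightarrow> nat) \<Rightarrow> real) \<Rightarrow>
     (nat \<Rightarrow> (nat \<Rightarrow> nat) \<Rightarrow> real) \<Rightarrow> ((nat \<Rightarrow> nat) \<Rightarrow> real) \<Rightarrow> bool" where
  "is_weighted_potential n k w c P \<longleftrightarrow>
     (\<forall>i\<in>{1..n}. \<forall>x\<in>{1..k i}. \<forall>y\<in>{1..k i}. \<forall>s\<in>profiles k ({1..n} - {i}).
        c i (s(i := x)) - c i (s(i := y)) = w i s * (P (s(i := x)) - P (s(i := y))))"

definition potential_games ::
    "nat \<Rightarrow> (nat \<Rightarrow> nat) \<Rightarrow> (nat \<Rightarrow> (nat \<Rightarrow> nat) \<Rightarrow> real) \<Rightarrow> real vec set" where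
  "potential_games n k w = {game_vec n k c |c. \<exists>P. is_weighted_potential n k w c P}"

definition pure_harmonic_games ::
    "nat \<Rightarrow> (nat \<Rightarrow> nat) \<Rightarrow> (nat \<Rightarrow> (nat \<Rightarrow> nat) \<Rightarrow> real) \<Rightarrow> real vec set" where
  "pure_harmonic_games n k w =
     vec_module.orthogonal_complement (game_dim n k) (potential_games n k w)"

definition harmonic_games ::
    "nat \<Rightarrow> (nat \<Rightarrow> nat) \<Rightarrow> (nat \<Rightarrow> (nat \<Rightarrow> nat) \<Rightarrow> real) \<Rightarrow> real vec set" where
  "harmonic_games n k w =
     LinearCombinations.module.submodule_sum (module_vec TYPE(real) (game_dim n k))
       (nonstrategic_games n k) (pure_harmonic_games n k w)"

section \<open>Direct sums and orthogonality of subspaces\<close>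

text \<open>\<open>W\<close> is the internal direct sum of the subspaces in the list \<open>Us\<close>: every element of
  \<open>W\<close> is in exactly one way a sum of one vector from each, and all such sums are in \<open>W\<close>.\<close>

definition is_direct_sum :: "nat \<Rightarrow> real vec set list \<Rightarrow> real vec set \<Rightarrow> bool" where
  "is_direct_sum d Us W \<longleftrightarrow>
     (\<forall>U\<in>set Us. subspace class_ring U (module_vec TYPE(real) d)) \<and>
     bij_betw (\<lambda>vs. foldr (+) vs (0\<^sub>v d)) (listset Us) W"

definition pairwise_orthogonal :: "real vec set list \<Rightarrow> bool" where
  "pairwise_orthogonal Us \<longleftrightarrow> sorted_wrt (\<lambda>U W. \<forall>u\<in>U. \<forall>v\<in>W. u \<bullet> v = 0) Us"

section \<open>Structure vectors are well defined\<close>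

fun profile_index :: "(nat \<Rightarrow> nat) \<Rightarrow> nat list \<Rightarrow> (nat \<Rightarrow> nat) \<Rightarrow> nat" where
  "profile_index k [] s = 0"
| "profile_index k (j # js) s = (s j - 1) * (\<Prod>l\<leftarrow>js. k l) + profile_index k js s"

lemma mult_add_less: "a < m \<Longrightarrow> b < p \<Longrightarrow> a * p + b < m * (p::nat)"
  by (metis add_less_cancel_left less_le_trans mult_Suc mult_le_mono1 Suc_leI add.commute)

lemma profile_index_less:
  assumes "\<forall>j\<in>set js. s j \<in> {1..k j}"
  shows "profile_index k js s < (\<Prod>l\<leftarrow>js. k l)"
  using assms by (induction js) (auto intro!: mult_add_less)

lemma kron_unit_vec:
  assumes "a < m" "b < p"
  shows "kron_vec (unit_vec m a) (unit_vec p b) = unit_vec (m * p) (a * p + b)"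
proof (rule eq_vecI)
  fix q assume "q < dim_vec (unit_vec (m * p) (a * p + b) :: real vec)"
  hence q: "q < m * p" by simp
  have p: "0 < p" using assms by auto
  have d: "q div p < m" using q by (simp add: less_mult_imp_div_less)
  have "(a * p + b) div p = a" "(a * p + b) mod p = b" using assms by auto
  moreover have "q = q div p * p + q mod p" by simp
  ultimately have "q = a * p + b \<longleftrightarrow> q div p = a \<and> q mod p = b" by metis
  thus "kron_vec (unit_vec m a) (unit_vec p b) $ q = unit_vec (m * p) (a * p + b) $ q"
    using q p d mult_add_less[OF assms] assms by (auto simp: kron_vec_def)
qed (simp add: kron_vec_def)

lemma foldr_kron_unit_vec:
  assumes "\<forall>j\<in>set js. s j \<in> {1..k j}"
  shows "foldr kron_vec (map (\<lambda>j. unit_vec (k j) (s j - 1)) js) (unit_vec 1 0)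
         = unit_vec (\<Prod>l\<leftarrow>js. k l) (profile_index k js s)"
  using assms
proof (induction js)
  case (Cons j js)
  have "s j - 1 < k j" using Cons.prems by auto
  thus ?case using Cons profile_index_less[of js s k] by (simp add: kron_unit_vec)
qed simp

lemma profile_index_inj:
  assumes "\<forall>j\<in>set js. s j \<in> {1..k j}" "\<forall>j\<in>set js. t j \<in> {1..k j}"
    and "profile_index k js s = profile_index k js t"
  shows "\<forall>j\<in>set js. s j = t j"
  using assms
proof (induction js)
  case (Cons j js)
  let ?p = "\<Prod>l\<leftarrow>js. k l"
  have l: "profile_index k js s < ?p" "profile_index k js t < ?p"
    using profile_index_less Cons.prems by auto
  have e: "(s j - 1) * ?p + profile_index k js s = (t j - 1) * ?p + profile_index k js t"
    using Cons.prems by simp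
  have dm: "(a * ?p + b) div ?p = a" "(a * ?p + b) mod ?p = b" if "b < ?p" for a b :: nat
    using that by (cases "?p = 0"; simp)+
  have "s j - 1 = t j - 1"
    using arg_cong[OF e, of "\<lambda>q. q div ?p"] l by (simp only: dm)
  moreover have "1 \<le> s j" "1 \<le> t j" using Cons.prems by auto
  ultimately have "s j = t j" by linarith
  moreover have "profile_index k js s = profile_index k js t"
    using arg_cong[OF e, of "\<lambda>q. q mod ?p"] l by (simp only: dm)
  hence "\<forall>j\<in>set js. s j = t j" by (rule Cons.IH[rotated 2]) (use Cons.prems in simp_all)
  ultimately show ?case by simp
qed simp

lemma profile_index_surj:
  assumes "distinct js" "q < (\<Prod>l\<leftarrow>js. k l)"
  shows "\<exists>s\<in>profiles k (set js). profile_index k js s = q"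
  using assms
proof (induction js arbitrary: q)
  case Nil
  thus ?case by (auto simp: profiles_def)
next
  case (Cons j js)
  let ?p = "\<Prod>l\<leftarrow>js. k l"
  have q: "q < k j * ?p" using Cons.prems by simp
  have p: "0 < ?p" using q by (cases ?p) auto
  have "q mod ?p < ?p" using p by simp
  then obtain s where s: "s \<in> profiles k (set js)" "profile_index k js s = q mod ?p"
    using Cons by auto
  have d: "q div ?p < k j" using q by (simp add: less_mult_imp_div_less)
  let ?s = "s(j := q div ?p + 1)"
  have j: "j \<notin> set js" using Cons.prems by simp
  have "profile_index k ls ?s = profile_index k ls s" if "j \<notin> set ls" for ls
    using that by (induction ls) auto
  hence "profile_index k (j # js) ?s = q" using s j by simp
  moreover have "?s \<in> profiles k (set (j # js))"
    using s d by (auto simp: profiles_def PiE_iff extensional_def)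
  ultimately show ?case by blast
qed

lemma ex1_structure_vec:
  assumes "finite J"
  shows "\<exists>!V. is_structure_vec k J f V"
proof -
  define js where "js = sorted_list_of_set J"
  have js: "distinct js" "set js = J" using assms by (auto simp: js_def)
  have K: "(\<Prod>l\<leftarrow>js. k l) = (\<Prod>j\<in>J. k j)"
    using js by (metis prod.distinct_set_conv_list)
  have mem: "\<forall>j\<in>set js. s j \<in> {1..k j}" if "s \<in> profiles k J" for s
    using that js by (auto simp: profiles_def PiE_iff)
  have pv: "V \<bullet> profile_vec k J s = V $ profile_index k js s"
    and lt: "profile_index k js s < (\<Prod>j\<in>J. k j)"
    if "s \<in> profiles k J" "V \<in> carrier_vec (\<Prod>j\<in>J. k j)" for s and V :: "real vec"
    using foldr_kron_unit_vec[OF mem[OF that(1)]] profile_index_less[OF mem[OF that(1)]] that(2) K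
    by (auto simp: profile_vec_def js_def[symmetric])
  have inj: "inj_on (profile_index k js) (profiles k J)"
  proof (rule inj_onI)
    fix s t assume st: "s \<in> profiles k J" "t \<in> profiles k J"
      "profile_index k js s = profile_index k js t"
    have "\<forall>j\<in>J. s j = t j" using profile_index_inj[OF mem mem] st js by blast
    thus "s = t" using st(1,2) unfolding profiles_def by (intro PiE_ext[of s J]) auto
  qed
  let ?V = "vec (\<Prod>j\<in>J. k j) (\<lambda>q. f (inv_into (profiles k J) (profile_index k js) q))"
  show ?thesis
  proof (rule ex1I)
    show "is_structure_vec k J f ?V"
      unfolding is_structure_vec_def using pv[of _ ?V] lt[of _ ?V] inj by auto
  next
    fix V assume V: "is_structure_vec k J f V"
    show "V = ?V"
    proof (rule eq_vecI)
      fix q assume q: "q < dim_vec ?V"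
      then obtain s where s: "s \<in> profiles k J" "profile_index k js s = q"
        using profile_index_surj[OF js(1), of q k] js(2) K by auto
      thus "V $ q = ?V $ q" using V q pv[of s V] inj by (auto simp: is_structure_vec_def)
    qed (use V in \<open>auto simp: is_structure_vec_def\<close>)
  qed
qed

end

(*
  Identify S_{-i} with the set of fibres of the map (coset_pos) that sends the position of a
  profile s to the position of s_{-i}; then E_i is the incidence matrix of this map. Row block i
  of B_cw_P maps a potential x to the deviation of x from its mean over each fibre, scaled by the
  weight of the fibre, while E_i produces exactly the vectors that are constant on the fibres.
  A deviation from the mean sums to zero on every fibre, so the two column spaces are orthogonal;
  and c_i differs from the deviation of a weighted potential by something constant on fibres, so
  their sum is the space of potential games. The decomposition of the whole space then follows by
  projecting onto the two orthogonal column spaces and subtracting.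
*)
theory Submission
  imports Defs
begin

subsection \<open>Orthogonal sums and projections\<close>

lemma subspace_vecI:
  fixes U :: "real vec set"
  assumes "U \<subseteq> carrier_vec d" "0\<^sub>v d \<in> U"
    and "\<And>u v. u \<in> U \<Longrightarrow> v \<in> U \<Longrightarrow> u + v \<in> U"
    and "\<And>a u. u \<in> U \<Longrightarrow> a \<cdot>\<^sub>v u \<in> U"
  shows "subspace class_ring U (module_vec TYPE(real) d)"
  unfolding subspace_def submodule_def
  using assms vec_vs[of d, where 'a = real] vec_module[of d, where 'a = real] by (auto simp: module_vec_simps)

lemma subspace_vecD:
  fixes U :: "real vec set"
  assumes "subspace class_ring U (module_vec TYPE(real) d)"
  shows "U \<subseteq> carrier_vec d" "0\<^sub>v d \<in> U"
    and "\<And>u v. u \<in> U \<Longrightarrow> v \<in> U \<Longrightarrow> u + v \<in> U"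
    and "\<And>a u. u \<in> U \<Longrightarrow> a \<cdot>\<^sub>v u \<in> U"
  using assms unfolding subspace_def submodule_def by (auto simp: module_vec_simps)

lemma subspace_vec_diff:
  fixes U :: "real vec set"
  assumes U: "subspace class_ring U (module_vec TYPE(real) d)" and "u \<in> U" "v \<in> U"
  shows "u - v \<in> U"
proof -
  have "u + (-1) \<cdot>\<^sub>v v \<in> U" using subspace_vecD(3,4)[OF U] assms by blast
  moreover have "u + (-1) \<cdot>\<^sub>v v = u - v"
    using subspace_vecD(1)[OF U] assms by (intro eq_vecI) auto
  ultimately show ?thesis by simp
qed

text \<open>Needed for two choices of \<open>u\<close>: a difference of two candidates for the first
  summand, when directness is proved, and the zero vector, for which orthogonality is automatic and
  only the carrier claim remains.\<close>

lemma foldr_add_listset: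
  fixes Us :: "real vec set list"
  assumes "\<forall>W\<in>set Us. W \<subseteq> carrier_vec d \<and> (\<forall>v\<in>W. u \<bullet> v = 0)" "u \<in> carrier_vec d"
    and "vs \<in> listset Us"
  shows "foldr (+) vs (0\<^sub>v d) \<in> carrier_vec d \<and> u \<bullet> foldr (+) vs (0\<^sub>v d) = 0"
  using assms(1,3)
proof (induction Us arbitrary: vs)
  case Nil
  thus ?case using assms(2) by auto
next
  case (Cons U Us)
  then obtain v vs' where v: "vs = v # vs'" "v \<in> U" "vs' \<in> listset Us"
    by (auto simp: set_Cons_def)
  hence "v \<in> carrier_vec d" "u \<bullet> v = 0" using Cons.prems by auto
  moreover have "foldr (+) vs' (0\<^sub>v d) \<in> carrier_vec d \<and> u \<bullet> foldr (+) vs' (0\<^sub>v d) = 0"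
    using Cons v by auto
  ultimately show ?case using v assms(2) by (auto simp: scalar_prod_add_distrib[of _ d])
qed

lemma foldr_add_listset_carrier:
  fixes Us :: "real vec set list"
  assumes "\<forall>W\<in>set Us. W \<subseteq> carrier_vec d" "vs \<in> listset Us"
  shows "foldr (+) vs (0\<^sub>v d) \<in> carrier_vec d"
  using foldr_add_listset[of Us d "0\<^sub>v d" vs] assms by fastforce

text \<open>Uniqueness by peeling off the first subspace: if \<open>v + s = v' + s'\<close>, then
  \<open>v - v' = s' - s\<close> lies in \<open>U\<close> and is also a difference of sums from
  subspaces orthogonal to \<open>U\<close>. It is therefore orthogonal to itself, hence zero, and
  the tails are equal by induction.\<close>

lemma is_direct_sum_orthogonal:
  assumes sub: "\<forall>U\<in>set Us. subspace class_ring U (module_vec TYPE(real) d)"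
    and orth: "pairwise_orthogonal Us"
    and sum_image: "(\<lambda>vs. foldr (+) vs (0\<^sub>v d)) ` listset Us = W"
  shows "is_direct_sum d Us W"
proof -
  have "inj_on (\<lambda>vs. foldr (+) vs (0\<^sub>v d)) (listset Us)"
    using sub orth
  proof (induction Us)
    case (Cons U Us)
    have U: "subspace class_ring U (module_vec TYPE(real) d)" using Cons by simp
    have car: "\<forall>W\<in>set Us. W \<subseteq> carrier_vec d" using Cons subspace_vecD(1) by force
    show ?case
    proof (rule inj_onI)
      fix vs vs' assume "vs \<in> listset (U # Us)" "vs' \<in> listset (U # Us)"
        and eq: "foldr (+) vs (0\<^sub>v d) = foldr (+) vs' (0\<^sub>v d)"
      then obtain v xs v' xs' where v: "vs = v # xs" "v \<in> U" "xs \<in> listset Us"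
        "vs' = v' # xs'" "v' \<in> U" "xs' \<in> listset Us"
        by (auto simp: set_Cons_def)
      define s s' where "s = foldr (+) xs (0\<^sub>v d)" "s' = foldr (+) xs' (0\<^sub>v d)"
      have c: "v \<in> carrier_vec d" "v' \<in> carrier_vec d" "s \<in> carrier_vec d" "s' \<in> carrier_vec d"
        using v subspace_vecD(1)[OF U] foldr_add_listset_carrier[OF car] unfolding s_s'_def by auto
      have e: "v + s = v' + s'" using eq v by (simp add: s_s'_def)
      have d: "v - v' \<in> U" by (rule subspace_vec_diff[OF U]) (use v in auto)
      have "\<forall>W\<in>set Us. W \<subseteq> carrier_vec d \<and> (\<forall>x\<in>W. (v - v') \<bullet> x = 0)"
        using car Cons.prems(2) d by (auto simp: pairwise_orthogonal_def)
      hence "(v - v') \<bullet> s = 0" "(v - v') \<bullet> s' = 0"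
        using foldr_add_listset[of Us d "v - v'"] v c unfolding s_s'_def by auto
      hence "(v - v') \<bullet> (s' - s) = 0" using c by (simp add: scalar_prod_minus_distrib[of _ d])
      moreover have "s' - s = v - v'"
      proof (rule eq_vecI)
        fix j assume "j < dim_vec (v - v')"
        thus "(s' - s) $ j = (v - v') $ j" using arg_cong[OF e, of "\<lambda>x. x $ j"] c by simp
      qed (use c in auto)
      ultimately have "v - v' = 0\<^sub>v d"
        using c conjugate_square_eq_0_vec[of "v - v'" d] by simp
      moreover have "x = y" if "x - y = 0\<^sub>v d" "x \<in> carrier_vec d" "y \<in> carrier_vec d" for x y :: "real vec"
      proof (rule eq_vecI)
        fix j assume "j < dim_vec y"
        thus "x $ j = y $ j" using arg_cong[OF that(1), of "\<lambda>x. x $ j"] that(2,3) by simp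
      qed (use that in auto)
      ultimately have vv: "v = v'" and "s = s'" using c \<open>s' - s = v - v'\<close> by metis+
      hence "xs = xs'" using Cons v unfolding s_s'_def
        by (auto simp: pairwise_orthogonal_def inj_on_def)
      thus "vs = vs'" using v vv by simp
    qed
  qed simp
  thus ?thesis using sub sum_image by (simp add: is_direct_sum_def bij_betw_def)
qed

text \<open>Gram-Schmidt as an induction over the spanning list: project both \<open>u\<close> and
  the new vector \<open>v\<close> onto the span of the tail, then correct the projection of
  \<open>u\<close> along the residual of \<open>v\<close>. The induction is general in
  \<open>u\<close> because its hypothesis is applied to \<open>u\<close> and to
  \<open>v\<close>.\<close>

lemma ex_projection_span:
  fixes vs :: "real vec list"
  assumes "set vs \<subseteq> carrier_vec d" "u \<in> carrier_vec d"
  shows "\<exists>p\<in>LinearCombinations.module.span class_ring (module_vec TYPE(real) d) (set vs). \<forall>v\<in>set vs. (u - p) \<bullet> v = 0"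
  using assms
proof (induction vs arbitrary: u)
  interpret vec_space "TYPE(real)" d .
  case Nil
  show ?case using span_zero by (auto simp: module_vec_simps)
next
  interpret vec_space "TYPE(real)" d .
  case (Cons v vs)
  let ?S = "span (set (v # vs))"
  have S: "subspace class_ring ?S (module_vec TYPE(real) d)"
    using Cons.prems(1) by (intro span_is_subspace) (auto simp: module_vec_simps)
  have mono: "span (set vs) \<subseteq> ?S" by (rule span_is_monotone) auto
  obtain p where p: "p \<in> span (set vs)" "\<forall>x\<in>set vs. (u - p) \<bullet> x = 0"
    using Cons.IH[of u] Cons.prems by auto
  obtain q where q: "q \<in> span (set vs)" "\<forall>x\<in>set vs. (v - q) \<bullet> x = 0"
    using Cons.IH[of v] Cons.prems by auto
  have vS: "v \<in> ?S" using in_own_span[OF Cons.prems(1)] by simp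
  have car: "u \<in> carrier_vec d" "v \<in> carrier_vec d" "p \<in> carrier_vec d" "q \<in> carrier_vec d"
    "\<And>x. x \<in> set vs \<Longrightarrow> x \<in> carrier_vec d"
    using Cons.prems p q span_closed[of "set vs"] by auto
  define r where "r = v - q"
  have r: "r \<in> carrier_vec d" "r \<in> ?S" using car subspace_vec_diff[OF S vS] q mono by (auto simp: r_def)
  \<comment> \<open>The coefficient of the projection of \<open>u - p\<close> onto \<open>r\<close>.
    If \<open>r\<close> vanishes, as it may for a dependent list, the quotient is 0 by convention;
    the case split below covers this.\<close>
  define a where "a = (u - p) \<bullet> r / (r \<bullet> r)"
  let ?p = "p + a \<cdot>\<^sub>v r"
  have P: "?p \<in> ?S" using subspace_vecD(3)[OF S _ subspace_vecD(4)[OF S r(2)]] p(1) mono by blast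
  have e: "(u - ?p) \<bullet> x = (u - p) \<bullet> x - a * (r \<bullet> x)" if x: "x \<in> carrier_vec d" for x
  proof -
    have "u - ?p = (u - p) - a \<cdot>\<^sub>v r" using car r by (intro eq_vecI) auto
    thus ?thesis using car r x by (simp add: minus_scalar_prod_distrib[of _ d])
  qed
  have vs: "(u - ?p) \<bullet> x = 0" if "x \<in> set vs" for x
    using that e p q car by (simp add: r_def)
  have r0: "(u - ?p) \<bullet> r = 0"
  proof (cases "r \<bullet> r = 0")
    case True
    hence "r = 0\<^sub>v d" using r conjugate_square_eq_0_vec[of r d] by simp
    thus ?thesis using car r by simp
  next
    case False
    hence "a * (r \<bullet> r) = (u - p) \<bullet> r" by (simp only: a_def times_divide_eq_left nonzero_mult_div_cancel_right not_False_eq_True)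
    thus ?thesis using e[OF r(1)] by linarith
  qed
  \<comment> \<open>\<open>q\<close> is only a combination of \<open>vs\<close>, so orthogonality to
    the generators is first extended to their span; with \<open>v = r + q\<close> orthogonality to
    \<open>v\<close> follows.\<close>
  have "(u - ?p) \<bullet> q = 0"
  proof -
    have "u - ?p \<in> orthogonal_complement (set vs)"
      using vs car r by (auto simp: orthogonal_complement_def)
    hence "u - ?p \<in> orthogonal_complement (span (set vs))"
      using in_orthogonal_complement_span[of "set vs"] car by blast
    thus ?thesis using q by (auto simp: orthogonal_complement_def)
  qed
  moreover have "v = r + q" using car by (intro eq_vecI) (auto simp: r_def)
  ultimately have "(u - ?p) \<bullet> v = 0"
    using r0 r car by (simp add: scalar_prod_add_distrib[of _ d])
  thus ?case using P vs by auto
qed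

lemma ex_projection_col_space:
  assumes A: "A \<in> carrier_mat d m" and u: "u \<in> carrier_vec d"
  shows "\<exists>p\<in>vec_space.col_space d (A :: real mat). \<forall>v\<in>vec_space.col_space d A. (u - p) \<bullet> v = 0"
proof -
  interpret vec_space "TYPE(real)" d .
  have c: "set (cols A) \<subseteq> carrier_vec d" using A cols_dim by blast
  obtain p where p: "p \<in> span (set (cols A))" "\<forall>v\<in>set (cols A). (u - p) \<bullet> v = 0"
    using ex_projection_span[OF c u] by auto
  have "p \<in> carrier_vec d" using p c span_closed[of "set (cols A)"] by auto
  hence "u - p \<in> orthogonal_complement (set (cols A))"
    using p u by (auto simp: orthogonal_complement_def)
  hence "u - p \<in> orthogonal_complement (span (set (cols A)))"
    using in_orthogonal_complement_span[OF c] by blast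
  thus ?thesis using p by (auto simp: orthogonal_complement_def col_space_def)
qed

lemma subspace_col_space:
  assumes A: "A \<in> carrier_mat d m"
  shows "subspace class_ring (vec_space.col_space d (A :: real mat)) (module_vec TYPE(real) d)"
proof -
  interpret vec_space "TYPE(real)" d .
  have "set (cols A) \<subseteq> carrier_vec d" using A cols_dim by blast
  thus ?thesis unfolding col_space_def by (intro span_is_subspace) (auto simp: module_vec_simps)
qed

lemma subspace_orthogonal_complement:
  assumes W: "W \<subseteq> carrier_vec d"
  shows "subspace class_ring (vec_module.orthogonal_complement d (W :: real vec set)) (module_vec TYPE(real) d)"
proof (rule subspace_vecI)
  let ?C = "vec_module.orthogonal_complement d W"
  have iff: "u \<in> ?C \<longleftrightarrow> u \<in> carrier_vec d \<and> (\<forall>v\<in>W. u \<bullet> v = 0)" for u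
    by (simp add: vec_module.orthogonal_complement_def)
  show "?C \<subseteq> carrier_vec d" using iff by blast
  show "0\<^sub>v d \<in> ?C" unfolding iff using W by auto
  show "u + v \<in> ?C" if "u \<in> ?C" "v \<in> ?C" for u v
    using that W unfolding iff by (auto simp: subset_iff add_scalar_prod_distrib[of u d v])
  show "a \<cdot>\<^sub>v u \<in> ?C" if "u \<in> ?C" for a u
    using that W unfolding iff by (auto simp: subset_iff)
qed

subsection \<open>Block vectors\<close>

lemma foldr_append_vec_carrier:
  assumes "\<forall>i\<in>set js. f i \<in> carrier_vec m"
  shows "foldr (@\<^sub>v) (map f js) vNil \<in> carrier_vec (length js * m)"
  using assms by (induction js) auto

lemma foldr_append_vec_scalar_prod:
  assumes "\<forall>i\<in>set js. f i \<in> carrier_vec m \<and> g i \<in> carrier_vec m"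
  shows "foldr (@\<^sub>v) (map f js) vNil \<bullet> foldr (@\<^sub>v) (map g js) vNil
         = (\<Sum>i\<leftarrow>js. f i \<bullet> (g i :: real vec))"
  using assms
proof (induction js)
  case Nil
  thus ?case by (simp add: scalar_prod_def)
next
  case (Cons j js)
  thus ?case
    using foldr_append_vec_carrier[of js f m] foldr_append_vec_carrier[of js g m]
    by (simp add: scalar_prod_append[of _ m _ "length js * m"])
qed

lemma foldr_append_vec_add:
  assumes "\<forall>i\<in>set js. f i \<in> carrier_vec m \<and> g i \<in> carrier_vec m"
  shows "foldr (@\<^sub>v) (map f js) vNil + foldr (@\<^sub>v) (map g js) vNil
         = foldr (@\<^sub>v) (map (\<lambda>i. f i + (g i :: real vec)) js) vNil"
  using assms
proof (induction js)
  case Nil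
  thus ?case by (intro eq_vecI) auto
next
  case (Cons j js)
  thus ?case
    using foldr_append_vec_carrier[of js f m] foldr_append_vec_carrier[of js g m]
    by (simp add: append_vec_add[of _ m _ _ "length js * m"])
qed

section \<open>Stacked and block diagonal matrices acting on block vectors\<close>

lemma foldr_append_rows_carrier:
  assumes "\<forall>i\<in>set js. A i \<in> carrier_mat m l"
  shows "foldr (@\<^sub>r) (map A js) (0\<^sub>m 0 l) \<in> carrier_mat (length js * m) l"
  using assms by (induction js) auto

lemma foldr_append_rows_mult_vec:
  fixes A :: "'a \<Rightarrow> real mat"
  assumes "\<forall>i\<in>set js. A i \<in> carrier_mat m l" "x \<in> carrier_vec l"
  shows "foldr (@\<^sub>r) (map A js) (0\<^sub>m 0 l) *\<^sub>v x = foldr (@\<^sub>v) (map (\<lambda>i. A i *\<^sub>v x) js) vNil"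
  using assms
proof (induction js)
  case Nil
  thus ?case by (intro eq_vecI) auto
next
  case (Cons j js)
  thus ?case
    using foldr_append_rows_carrier[of js A m l]
    by (simp add: mat_mult_append[of _ m l _ "length js * m"])
qed

lemma diag_block_mat_carrier:
  assumes "\<forall>i\<in>set js. A i \<in> carrier_mat m (l i)"
  shows "diag_block_mat (map A js) \<in> carrier_mat (length js * m) (\<Sum>i\<leftarrow>js. l i)"
  using assms by (induction js) (auto simp: Let_def)

lemma diag_block_mat_Cons_mult_vec:
  fixes A :: "'a \<Rightarrow> real mat"
  assumes "\<forall>i\<in>set (j # js). A i \<in> carrier_mat m (l i)"
    and "a \<in> carrier_vec (l j)" "b \<in> carrier_vec (\<Sum>i\<leftarrow>js. l i)"
  shows "diag_block_mat (map A (j # js)) *\<^sub>v (a @\<^sub>v b)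
         = (A j *\<^sub>v a) @\<^sub>v (diag_block_mat (map A js) *\<^sub>v b)"
proof -
  let ?D = "diag_block_mat (map A js)"
  have A: "A j \<in> carrier_mat m (l j)" using assms by simp
  have D: "?D \<in> carrier_mat (length js * m) (\<Sum>i\<leftarrow>js. l i)"
    using assms diag_block_mat_carrier[of js A m l] by simp
  have "diag_block_mat (map A (j # js)) =
      four_block_mat (A j) (0\<^sub>m m (\<Sum>i\<leftarrow>js. l i)) (0\<^sub>m (length js * m) (l j)) ?D"
    using A D by (simp add: Let_def)
  thus ?thesis
    using A D assms
      four_block_mat_mult_vec[OF A zero_carrier_mat zero_carrier_mat D assms(2,3)]
    by auto
qed

text \<open>The argument \<open>y\<close> is cut into one piece per block. Pieces are indexed by the
  entries of \<open>js\<close>, not by places in the list, so distinctness ensures that storing the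
  head piece at \<open>j\<close> leaves the others unchanged.\<close>

lemma diag_block_mat_mult_vec_eq_foldr:
  fixes A :: "'a \<Rightarrow> real mat"
  assumes "\<forall>i\<in>set js. A i \<in> carrier_mat m (l i)" "distinct js"
    and "y \<in> carrier_vec (\<Sum>i\<leftarrow>js. l i)"
  shows "\<exists>z. (\<forall>i\<in>set js. z i \<in> carrier_vec (l i)) \<and>
     diag_block_mat (map A js) *\<^sub>v y = foldr (@\<^sub>v) (map (\<lambda>i. A i *\<^sub>v z i) js) vNil"
  using assms
proof (induction js arbitrary: y)
  case Nil
  thus ?case by (auto intro!: eq_vecI)
next
  case (Cons j js)
  define a b where "a = vec_first y (l j)" and "b = vec_last y (\<Sum>i\<leftarrow>js. l i)"
  have ab: "a \<in> carrier_vec (l j)" "b \<in> carrier_vec (\<Sum>i\<leftarrow>js. l i)" "y = a @\<^sub>v b"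
    using Cons.prems unfolding a_def b_def by auto
  obtain z where z: "\<forall>i\<in>set js. z i \<in> carrier_vec (l i)"
    "diag_block_mat (map A js) *\<^sub>v b = foldr (@\<^sub>v) (map (\<lambda>i. A i *\<^sub>v z i) js) vNil"
    using Cons.IH[OF _ _ ab(2)] Cons.prems by auto
  have "map (\<lambda>i. A i *\<^sub>v (z(j := a)) i) js = map (\<lambda>i. A i *\<^sub>v z i) js"
    using Cons.prems by auto
  hence "diag_block_mat (map A (j # js)) *\<^sub>v y
      = foldr (@\<^sub>v) (map (\<lambda>i. A i *\<^sub>v (z(j := a)) i) (j # js)) vNil"
    using diag_block_mat_Cons_mult_vec[OF Cons.prems(1) ab(1,2)] ab(3) z(2)
    by (simp only: list.map foldr.simps fun_upd_same o_apply)
  moreover have "\<forall>i\<in>set (j # js). (z(j := a)) i \<in> carrier_vec (l i)" using z ab by auto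
  ultimately show ?case by blast
qed

text \<open>Gluing the pieces together reverses the cutting; the two directions together describe
  the column space of a block diagonal matrix.\<close>

lemma foldr_eq_diag_block_mat_mult_vec:
  fixes A :: "'a \<Rightarrow> real mat"
  assumes "\<forall>i\<in>set js. A i \<in> carrier_mat m (l i) \<and> z i \<in> carrier_vec (l i)"
  shows "\<exists>y\<in>carrier_vec (\<Sum>i\<leftarrow>js. l i).
     diag_block_mat (map A js) *\<^sub>v y = foldr (@\<^sub>v) (map (\<lambda>i. A i *\<^sub>v z i) js) vNil"
  using assms
proof (induction js)
  case Nil
  show ?case by (intro bexI[of _ vNil] eq_vecI) auto
next
  case (Cons j js)
  then obtain y where y: "y \<in> carrier_vec (\<Sum>i\<leftarrow>js. l i)"
    "diag_block_mat (map A js) *\<^sub>v y = foldr (@\<^sub>v) (map (\<lambda>i. A i *\<^sub>v z i) js) vNil"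
    by auto
  have "diag_block_mat (map A (j # js)) *\<^sub>v (z j @\<^sub>v y)
      = foldr (@\<^sub>v) (map (\<lambda>i. A i *\<^sub>v z i) (j # js)) vNil"
    using diag_block_mat_Cons_mult_vec[of j js A m l "z j" y] Cons.prems y by simp
  moreover have "z j @\<^sub>v y \<in> carrier_vec (\<Sum>i\<leftarrow>j # js. l i)"
    using Cons.prems y(1) by simp
  ultimately show ?case by blast
qed

subsection \<open>Incidence matrices of a map with finite fibres\<close>

text \<open>When \<open>h\<close> maps below \<open>l\<close>, this matrix pulls a vector back along
  \<open>h\<close>, and its transpose sums over the fibres. So \<open>E * E\<^sup>T\<close> replaces
  each entry by the sum over its fibre.\<close>

definition fibre_mat :: "nat \<Rightarrow> nat \<Rightarrow> (nat \<Rightarrow> nat) \<Rightarrow> real mat" where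
  "fibre_mat m l h = mat m l (\<lambda>(p, q). if q = h p then 1 else 0)"

lemma fibre_mat_carrier [simp]: "fibre_mat m l h \<in> carrier_mat m l"
  by (simp add: fibre_mat_def)

lemma fibre_mat_mult_vec:
  assumes "h p < l" "p < m" "y \<in> carrier_vec l"
  shows "(fibre_mat m l h *\<^sub>v y) $ p = y $ h p"
  using assms by (simp add: fibre_mat_def scalar_prod_def if_distrib if_distribR cong: if_cong)

lemma fibre_mat_transpose_mult_vec:
  assumes "q < l" "x \<in> carrier_vec m"
  shows "((fibre_mat m l h)\<^sup>T *\<^sub>v x) $ q = (\<Sum>p | p < m \<and> h p = q. x $ p)"
proof -
  have "((fibre_mat m l h)\<^sup>T *\<^sub>v x) $ q = (\<Sum>p = 0..<m. if h p = q then x $ p else 0)"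
    using assms by (auto simp: fibre_mat_def scalar_prod_def intro!: sum.cong)
  also have "\<dots> = (\<Sum>p | p < m \<and> h p = q. x $ p)"
    by (simp add: sum.If_cases Collect_conj_eq lessThan_def[symmetric] atLeast0LessThan)
  finally show ?thesis .
qed

lemma mat_diag_mult_vec:
  assumes "x \<in> carrier_vec m"
  shows "mat_diag m g *\<^sub>v x = vec m (\<lambda>p. g p * (x $ p :: real))"
  using assms
  by (intro eq_vecI) (auto simp: mat_diag_def scalar_prod_def if_distrib if_distribR cong: if_cong)

text \<open>When \<open>c\<close> is the reciprocal of a common fibre size, the bracket is the
  deviation of \<open>x\<close> from its fibre mean, and the diagonal factor multiplies it by a
  weight constant on the fibre.\<close>

lemma weighted_deviation_mult_vec:
  fixes c :: real
  assumes h: "\<And>p. p < m \<Longrightarrow> h p < l" and W: "W \<in> carrier_vec l"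
    and x: "x \<in> carrier_vec m" and p: "p < m"
  defines "E \<equiv> fibre_mat m l h"
  defines "D \<equiv> mat_diag m (\<lambda>p. (E *\<^sub>v W) $ p)"
  shows "((D - c \<cdot>\<^sub>m (D * E * E\<^sup>T)) *\<^sub>v x) $ p = W $ h p * (x $ p - c * (\<Sum>p' | p' < m \<and> h p' = h p. x $ p'))"
proof -
  have E: "E \<in> carrier_mat m l" "E\<^sup>T \<in> carrier_mat l m" by (simp_all add: E_def)
  have D: "D \<in> carrier_mat m m" by (simp add: D_def)
  have Ex: "E\<^sup>T *\<^sub>v x \<in> carrier_vec l" "E *\<^sub>v (E\<^sup>T *\<^sub>v x) \<in> carrier_vec m" using E x by auto
  have "(D - c \<cdot>\<^sub>m (D * E * E\<^sup>T)) *\<^sub>v x = D *\<^sub>v x - (c \<cdot>\<^sub>m (D * E * E\<^sup>T)) *\<^sub>v x"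
    using D E x by (intro minus_mult_distrib_mat_vec[of _ m m]) auto
  also have "(c \<cdot>\<^sub>m (D * E * E\<^sup>T)) *\<^sub>v x = c \<cdot>\<^sub>v (D *\<^sub>v (E *\<^sub>v (E\<^sup>T *\<^sub>v x)))"
  proof (rule eq_vecI)
    \<comment> \<open>The factors act one at a time: \<open>E\<^sup>T\<close> forms fibre sums,
      \<open>E\<close> copies them back to all points of the fibre, and \<open>D\<close> weights
      them.\<close>
    have e: "D * E * E\<^sup>T *\<^sub>v x = D *\<^sub>v (E *\<^sub>v (E\<^sup>T *\<^sub>v x))"
      using assoc_mult_mat_vec[OF mult_carrier_mat[OF D E(1)] E(2) x]
        assoc_mult_mat_vec[OF D E(1) Ex(1)] by simp
    show "((c \<cdot>\<^sub>m (D * E * E\<^sup>T)) *\<^sub>v x) $ j = (c \<cdot>\<^sub>v (D *\<^sub>v (E *\<^sub>v (E\<^sup>T *\<^sub>v x)))) $ j"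
      if "j < dim_vec (c \<cdot>\<^sub>v (D *\<^sub>v (E *\<^sub>v (E\<^sup>T *\<^sub>v x))))" for j
      using that D E x arg_cong[OF e, of "\<lambda>v. v $ j"] by (simp del: assoc_mult_mat)
  qed (use D E in simp)
  finally have "(D - c \<cdot>\<^sub>m (D * E * E\<^sup>T)) *\<^sub>v x = D *\<^sub>v x - c \<cdot>\<^sub>v (D *\<^sub>v (E *\<^sub>v (E\<^sup>T *\<^sub>v x)))" .
  moreover have "(E *\<^sub>v W) $ p = W $ h p" using fibre_mat_mult_vec[of h p l m W] h W p by (simp add: E_def)
  moreover have "(E *\<^sub>v (E\<^sup>T *\<^sub>v x)) $ p = (\<Sum>p' | p' < m \<and> h p' = h p. x $ p')"
    using fibre_mat_mult_vec[of h p l m "E\<^sup>T *\<^sub>v x"] fibre_mat_transpose_mult_vec[of "h p" l x m h] h p x Ex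
    by (simp add: E_def)
  ultimately show ?thesis
    using D E Ex x p by (simp add: D_def mat_diag_mult_vec algebra_simps)
qed

text \<open>On a single fibre the weight and the entry of \<open>y\<close> are both constant and
  factor out, leaving a sum of deviations from a mean, which is zero.\<close>

lemma weighted_deviation_orthogonal:
  fixes c :: nat
  assumes h: "\<And>p. p < m \<Longrightarrow> h p < l" and W: "W \<in> carrier_vec l"
    and x: "x \<in> carrier_vec m" and y: "y \<in> carrier_vec l"
    and card: "\<And>q. q < l \<Longrightarrow> card {p. p < m \<and> h p = q} = c"
    and v: "v \<in> carrier_vec m"
    and v': "\<And>p. p < m \<Longrightarrow> v $ p = W $ h p * (x $ p - (1 / c) * (\<Sum>p' | p' < m \<and> h p' = h p. x $ p'))"
  shows "v \<bullet> (fibre_mat m l h *\<^sub>v y) = 0"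
proof -
  let ?F = "\<lambda>q. {p. p < m \<and> h p = q}"
  have z: "(\<Sum>p\<in>?F q. v $ p * y $ h p) = 0" if q: "q < l" for q
  \<comment> \<open>A nonempty fibre forces \<open>c\<close> to be nonzero, which is what lets
    \<open>card\<close> cancel against \<open>1 / c\<close>; an empty fibre contributes an empty
    sum.\<close>
  proof (cases "?F q = {}")
    case False
    have "card (?F q) \<noteq> 0" using False by (subst card_0_eq) auto
    hence c: "c \<noteq> 0" using card[OF q] by simp
    have "(\<Sum>p\<in>?F q. v $ p * y $ h p)
        = (\<Sum>p\<in>?F q. W $ q * y $ q * (x $ p - (1 / c) * (\<Sum>p'\<in>?F q. x $ p')))"
      by (intro sum.cong) (auto simp: v')
    also have "\<dots> = W $ q * y $ q * ((\<Sum>p\<in>?F q. x $ p) - card (?F q) * ((1 / c) * (\<Sum>p'\<in>?F q. x $ p')))"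
      by (simp add: sum_distrib_left[symmetric] sum_subtractf)
    also have "\<dots> = 0" using c card[OF q] by simp
    finally show ?thesis .
  qed (simp only: sum.empty)
  have "v \<bullet> (fibre_mat m l h *\<^sub>v y) = (\<Sum>p\<in>{..<m}. v $ p * y $ h p)"
    using fibre_mat_mult_vec[of h _ l m y] h y
    by (simp add: scalar_prod_def lessThan_atLeast0 fibre_mat_def)
  \<comment> \<open>The inner product is regrouped by fibres.\<close>
  also have "\<dots> = (\<Sum>q<l. \<Sum>p\<in>{p \<in> {..<m}. h p = q}. v $ p * y $ h p)"
    using h by (intro sum.group[symmetric]) auto
  also have "\<dots> = 0" using z by simp
  finally show ?thesis .
qed

text \<open>Reading one representative per fibre gives a preimage. This recognises the non-strategic
  part of a game.\<close>

lemma constant_on_fibres_in_range: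
  assumes h: "\<And>p. p < m \<Longrightarrow> h p < l" and d: "d \<in> carrier_vec m"
    and const: "\<And>p p'. p < m \<Longrightarrow> p' < m \<Longrightarrow> h p = h p' \<Longrightarrow> d $ p = d $ p'"
  shows "\<exists>y\<in>carrier_vec l. fibre_mat m l h *\<^sub>v y = d"
proof
  \<comment> \<open>Over an empty fibre the chosen representative is arbitrary, but row
    \<open>p\<close> reads only the entry \<open>h p\<close>, whose fibre contains
    \<open>p\<close>.\<close>
  let ?y = "vec l (\<lambda>q. d $ (SOME p. p < m \<and> h p = q))"
  show "fibre_mat m l h *\<^sub>v ?y = d"
  proof (rule eq_vecI)
    fix p assume "p < dim_vec d"
    hence p: "p < m" using d by simp
    have "(SOME p'. p' < m \<and> h p' = h p) < m \<and> h (SOME p'. p' < m \<and> h p' = h p) = h p"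
      by (rule someI[of _ p]) (use p in simp)
    hence "d $ (SOME p'. p' < m \<and> h p' = h p) = d $ p" using const p by metis
    thus "(fibre_mat m l h *\<^sub>v ?y) $ p = d $ p"
      using fibre_mat_mult_vec[of h p l m ?y] h p by simp
  qed (use d in \<open>simp add: fibre_mat_def\<close>)
qed simp

subsection \<open>Indices of profiles\<close>

lemma sorted_list_of_players: "sorted_list_of_set {1..n} = [1..<n + 1]"
  by (metis atLeastLessThanSuc_atLeastAtMost sorted_list_of_set_range Suc_eq_plus1)

lemma sorted_list_of_players_minus:
  assumes "i \<in> {1..n}"
  shows "sorted_list_of_set ({1..n} - {i}) = [1..<i] @ [i + 1..<n + 1]"
proof -
  have "set ([1..<i] @ [i + 1..<n + 1]) = {1..n} - {i}" using assms by auto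
  moreover have "sorted ([1..<i] @ [i + 1..<n + 1])" "distinct ([1..<i] @ [i + 1..<n + 1])"
    by (auto simp: sorted_append)
  ultimately show ?thesis by (metis sorted_list_of_set.idem_if_sorted_distinct)
qed

lemma upt_players: "i \<in> {1..n} \<Longrightarrow> [1..<n + 1] = [1..<i] @ i # [i + 1..<n + 1]"
  using upt_add_eq_append[of 1 i "n + 1 - i"] by (auto simp: upt_conv_Cons)

lemma profile_index_append:
  "profile_index k (xs @ ys) s = profile_index k xs s * (\<Prod>l\<leftarrow>ys. k l) + profile_index k ys s"
  by (induction xs) (auto simp: algebra_simps)

lemma profile_index_cong:
  "(\<And>j. j \<in> set js \<Longrightarrow> s j = t j) \<Longrightarrow> profile_index k js s = profile_index k js t"
  by (induction js) auto

text \<open>The mixed-radix number of a profile, with the smallest player most significant. The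
  Kronecker product of its unit vectors is the unit vector at this position, so a structure vector
  is a table of values indexed by positions.\<close>

definition profile_pos :: "(nat \<Rightarrow> nat) \<Rightarrow> nat set \<Rightarrow> (nat \<Rightarrow> nat) \<Rightarrow> nat" where
  "profile_pos k J = profile_index k (sorted_list_of_set J)"

lemma prod_list_sorted_list_of_set:
  "finite J \<Longrightarrow> (\<Prod>l\<leftarrow>sorted_list_of_set J. k l) = (\<Prod>j\<in>J. k j :: nat)"
  by (metis distinct_sorted_list_of_set prod.distinct_set_conv_list set_sorted_list_of_set)

lemma profiles_mem: "s \<in> profiles k J \<Longrightarrow> j \<in> J \<Longrightarrow> s j \<in> {1..k j}"
  by (auto simp: profiles_def PiE_iff)

lemma profile_pos_less:
  assumes "finite J" "s \<in> profiles k J"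
  shows "profile_pos k J s < (\<Prod>j\<in>J. k j)"
  using profile_index_less[of "sorted_list_of_set J" s k] assms profiles_mem[OF assms(2)]
  by (auto simp: profile_pos_def prod_list_sorted_list_of_set)

lemma profile_pos_surj:
  assumes "finite J" "p < (\<Prod>j\<in>J. k j)"
  shows "\<exists>s\<in>profiles k J. profile_pos k J s = p"
  using profile_index_surj[of "sorted_list_of_set J" p k] assms
  by (simp add: profile_pos_def prod_list_sorted_list_of_set)

lemma profile_pos_inj:
  assumes "finite J" "s \<in> profiles k J" "t \<in> profiles k J" "profile_pos k J s = profile_pos k J t"
  shows "s = t"
proof -
  have "\<forall>j\<in>J. s j = t j"
    using profile_index_inj[of "sorted_list_of_set J" s k t] assms profiles_mem
    by (simp add: profile_pos_def)
  thus ?thesis using assms unfolding profiles_def by (intro PiE_ext[of s J]) auto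
qed

lemma profile_vec_eq_unit_vec:
  assumes "finite J" "s \<in> profiles k J"
  shows "profile_vec k J s = unit_vec (\<Prod>j\<in>J. k j) (profile_pos k J s)"
  using foldr_kron_unit_vec[of "sorted_list_of_set J" s k] assms profiles_mem[OF assms(2)]
  by (simp add: profile_vec_def profile_pos_def prod_list_sorted_list_of_set)

lemma is_structure_vec_iff:
  assumes "finite J"
  shows "is_structure_vec k J f V \<longleftrightarrow>
    V \<in> carrier_vec (\<Prod>j\<in>J. k j) \<and> (\<forall>s\<in>profiles k J. V $ profile_pos k J s = f s)"
  using assms profile_pos_less[OF assms]
  by (auto simp: is_structure_vec_def profile_vec_eq_unit_vec)

lemma is_structure_vec_structure_vec: "finite J \<Longrightarrow> is_structure_vec k J f (structure_vec k J f)"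
  unfolding structure_vec_def by (rule theI') (rule ex1_structure_vec)

lemma structure_vec_carrier: "finite J \<Longrightarrow> structure_vec k J f \<in> carrier_vec (\<Prod>j\<in>J. k j)"
  using is_structure_vec_structure_vec is_structure_vec_def by blast

lemma structure_vec_index:
  "finite J \<Longrightarrow> s \<in> profiles k J \<Longrightarrow> structure_vec k J f $ profile_pos k J s = f s"
  using is_structure_vec_structure_vec[of J k f] by (simp add: is_structure_vec_iff)

text \<open>By uniqueness of structure vectors, a vector is recovered from the function that reads
  off its entries; this turns blocks of a vector back into payoffs.\<close>

lemma structure_vec_of_vec:
  assumes "finite J" "v \<in> carrier_vec (\<Prod>j\<in>J. k j)"
  shows "structure_vec k J (\<lambda>s. v $ profile_pos k J s) = v"
  using ex1_structure_vec[OF assms(1)] is_structure_vec_structure_vec[OF assms(1)]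
    is_structure_vec_iff[OF assms(1)] assms(2) by blast

text \<open>The position of \<open>s\<^bsub>-i\<^esub>\<close> as a function of the position of \<open>s\<close>: with \<open>R\<close> the number of
  profiles of the players after \<open>i\<close>, the mixed-radix digit of player \<open>i\<close> is dropped.\<close>

definition coset_pos :: "nat \<Rightarrow> (nat \<Rightarrow> nat) \<Rightarrow> nat \<Rightarrow> nat \<Rightarrow> nat" where
  "coset_pos n k i p = p div (\<Prod>j\<in>{i<..n}. k j) div k i * (\<Prod>j\<in>{i<..n}. k j) + p mod (\<Prod>j\<in>{i<..n}. k j)"

lemma prod_players_split:
  fixes i n :: nat
  assumes "i \<in> {1..n}"
  shows "(\<Prod>j\<in>{1..n}. k j :: nat) = (\<Prod>j\<in>{1..<i}. k j) * k i * (\<Prod>j\<in>{i<..n}. k j)"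
    and "(\<Prod>j\<in>{1..n} - {i}. k j :: nat) = (\<Prod>j\<in>{1..<i}. k j) * (\<Prod>j\<in>{i<..n}. k j)"
proof -
  have split: "{1..n} - {i} = {1..<i} \<union> {i<..n}" using assms by auto
  show minus: "(\<Prod>j\<in>{1..n} - {i}. k j :: nat) = (\<Prod>j\<in>{1..<i}. k j) * (\<Prod>j\<in>{i<..n}. k j)"
    unfolding split by (rule prod.union_disjoint) auto
  show "(\<Prod>j\<in>{1..n}. k j :: nat) = (\<Prod>j\<in>{1..<i}. k j) * k i * (\<Prod>j\<in>{i<..n}. k j)"
    using prod.remove[of "{1..n}" i k] assms minus by simp
qed

lemma prod_list_upt_after: "(\<Prod>l\<leftarrow>[i + 1..<n + 1]. k l) = (\<Prod>j\<in>{i<..n}. k j :: nat)"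
proof -
  have "set [i + 1..<n + 1] = {i<..n}" by auto
  thus ?thesis by (metis distinct_upt prod.distinct_set_conv_list)
qed

text \<open>The position of \<open>s\<close> is \<open>(a * k i + (s i - 1)) * R + b\<close>, with
  \<open>a\<close> and \<open>b\<close> coding the players before and after \<open>i\<close>, and
  that of the partial profile is \<open>a * R + b\<close>. Division with remainder recovers both
  outer digits.\<close>

lemma coset_pos_profile_pos:
  assumes i: "i \<in> {1..n}" and s: "s \<in> profiles k {1..n}"
  shows "coset_pos n k i (profile_pos k {1..n} s) = profile_pos k ({1..n} - {i}) s"
proof -
  let ?R = "\<Prod>j\<in>{i<..n}. k j"
  let ?a = "profile_index k [1..<i] s" and ?b = "profile_index k [i + 1..<n + 1] s"
  have dm: "((a * c + x) * r + b) div r div c * r + ((a * c + x) * r + b) mod r = a * r + b"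
    if "b < r" "x < c" for a b c r x :: nat
    using that by simp
  have b: "?b < ?R"
    using profile_index_less[of "[i + 1..<n + 1]" s k] profiles_mem[OF s] i
    unfolding prod_list_upt_after by auto
  \<comment> \<open>Strategies are numbered from 1, so the digit of player \<open>i\<close> is
    \<open>s i - 1\<close>.\<close>
  have si: "s i - 1 < k i" using profiles_mem[OF s i] by auto
  have p: "profile_pos k {1..n} s = (?a * k i + (s i - 1)) * ?R + ?b"
    unfolding profile_pos_def sorted_list_of_players upt_players[OF i] profile_index_append
    by (simp add: prod_list_upt_after[simplified] algebra_simps)
  have q: "profile_pos k ({1..n} - {i}) s = ?a * ?R + ?b"
    unfolding profile_pos_def sorted_list_of_players_minus[OF i] profile_index_append
      prod_list_upt_after ..
  show ?thesis unfolding coset_pos_def p q by (rule dm[OF b si])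
qed

lemma coset_pos_less:
  assumes i: "i \<in> {1..n}" and p: "p < (\<Prod>j\<in>{1..n}. k j)"
  shows "coset_pos n k i p < (\<Prod>j\<in>{1..n} - {i}. k j)"
proof -
  let ?L = "\<Prod>j\<in>{1..<i}. k j" and ?R = "\<Prod>j\<in>{i<..n}. k j"
  have p': "p < ?L * k i * ?R" using p prod_players_split(1)[OF i] by simp
  \<comment> \<open>A position below the total product exists, so no factor of that product
    vanishes.\<close>
  hence "0 < ?R" by (cases "?R = 0") auto
  moreover have "p div ?R div k i < ?L" using p' by (simp add: less_mult_imp_div_less)
  ultimately show ?thesis
    unfolding coset_pos_def prod_players_split(2)[OF i] by (intro mult_add_less) auto
qed

text \<open>The fibre over \<open>q\<close> is obtained by inserting each possible digit
  \<open>x < k i\<close> at the place of player \<open>i\<close>; distinct digits give distinct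
  positions.\<close>

lemma card_coset_pos_fibre:
  assumes i: "i \<in> {1..n}" and q: "q < (\<Prod>j\<in>{1..n} - {i}. k j)"
  shows "card {p. p < (\<Prod>j\<in>{1..n}. k j) \<and> coset_pos n k i p = q} = k i"
proof -
  let ?L = "\<Prod>j\<in>{1..<i}. k j" and ?R = "\<Prod>j\<in>{i<..n}. k j"
  let ?f = "\<lambda>x. (q div ?R * k i + x) * ?R + q mod ?R"
  have q': "q < ?L * ?R" using q unfolding prod_players_split(2)[OF i] .
  hence R: "0 < ?R" by (cases "?R = 0") auto
  have L: "q div ?R < ?L" using q' by (simp add: less_mult_imp_div_less)
  have "inj_on ?f {..<k i}" using R by (intro inj_onI) auto
  moreover have "{p. p < (\<Prod>j\<in>{1..n}. k j) \<and> coset_pos n k i p = q} = ?f ` {..<k i}"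
  proof (intro equalityI subsetI)
    fix p assume "p \<in> {p. p < (\<Prod>j\<in>{1..n}. k j) \<and> coset_pos n k i p = q}"
    hence p: "p < ?L * k i * ?R" "coset_pos n k i p = q" using prod_players_split(1)[OF i] by auto
    have "0 < k i" using p(1) by (cases "k i = 0") auto
    hence lt: "p div ?R mod k i < k i" by simp
    have "q div ?R = p div ?R div k i" "q mod ?R = p mod ?R"
      using p(2) R unfolding coset_pos_def by auto
    hence "p = ?f (p div ?R mod k i)" by (simp only: div_mult_mod_eq)
    thus "p \<in> ?f ` {..<k i}" using lt by blast
  next
    fix p assume "p \<in> ?f ` {..<k i}"
    then obtain x where x: "x < k i" "p = ?f x" by auto
    have "p < ?L * k i * ?R" unfolding x using R by (intro mult_add_less L x) simp
    moreover have "coset_pos n k i p = q" unfolding coset_pos_def x(2) using R x(1)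
      by (simp add: div_mult_mod_eq[of q ?R])
    ultimately show "p \<in> {p. p < (\<Prod>j\<in>{1..n}. k j) \<and> coset_pos n k i p = q}"
      using prod_players_split(1)[OF i] by simp
  qed
  ultimately show ?thesis by (simp add: card_image)
qed

text \<open>A row index has three digits and a column index two. The identity factors compare the
  outer digits, while the column of ones ignores the digit of player \<open>i\<close>; the entry is
  1 exactly when dropping that digit yields the column index.\<close>

lemma E_mat_eq_fibre_mat:
  assumes i: "i \<in> {1..n}"
  shows "E_mat n k i = fibre_mat (\<Prod>j\<in>{1..n}. k j) (\<Prod>j\<in>{1..n} - {i}. k j) (coset_pos n k i)"
proof (rule eq_matI)
  let ?L = "\<Prod>j\<in>{1..<i}. k j" and ?R = "\<Prod>j\<in>{i<..n}. k j"
  let ?F = "fibre_mat (\<Prod>j\<in>{1..n}. k j) (\<Prod>j\<in>{1..n} - {i}. k j) (coset_pos n k i)"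
  show "dim_row (E_mat n k i) = dim_row ?F" "dim_col (E_mat n k i) = dim_col ?F"
    unfolding E_mat_def kron_mat_def fibre_mat_def prod_players_split[OF i] by simp_all
  fix p q assume "p < dim_row ?F" "q < dim_col ?F"
  hence p: "p < ?L * k i * ?R" and q: "q < ?L * ?R"
    unfolding fibre_mat_def prod_players_split[OF i] by simp_all
  have R: "0 < ?R" using p by (cases "?R = 0") auto
  have d: "p div ?R < ?L * k i" "q div ?R < ?L" "p div ?R div k i < ?L"
    using p q by (simp_all add: less_mult_imp_div_less)
  have ki: "0 < k i" using p by (cases "k i = 0") auto
  have "E_mat n k i $$ (p, q) =
      (if p div ?R div k i = q div ?R then 1 else 0) * (if p mod ?R = q mod ?R then 1 else 0)"
    unfolding E_mat_def kron_mat_def using p q R d ki by simp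
  moreover have "p div ?R div k i = q div ?R \<and> p mod ?R = q mod ?R \<longleftrightarrow> q = coset_pos n k i p"
  proof
    assume "p div ?R div k i = q div ?R \<and> p mod ?R = q mod ?R"
    thus "q = coset_pos n k i p" by (simp only: coset_pos_def div_mult_mod_eq)
  next
    assume "q = coset_pos n k i p"
    thus "p div ?R div k i = q div ?R \<and> p mod ?R = q mod ?R" using R by (simp add: coset_pos_def)
  qed
  ultimately show "E_mat n k i $$ (p, q) = ?F $$ (p, q)"
    using p q unfolding fibre_mat_def prod_players_split[OF i] by auto
qed

subsection \<open>The subspaces of games\<close>

text \<open>Row block \<open>i\<close> of \<open>B_cw_P\<close>, whose column space consists of the
  pure potential games.\<close>

definition pure_block :: "nat \<Rightarrow> (nat \<Rightarrow> nat) \<Rightarrow> (nat \<Rightarrow> (nat \<Rightarrow> nat) \<Rightarrow> real) \<Rightarrow> nat \<Rightarrow> real mat" where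
  "pure_block n k w i = Lambda_mat n k w i
     - (1 / real (k i)) \<cdot>\<^sub>m (Lambda_mat n k w i * E_mat n k i * (E_mat n k i)\<^sup>T)"

lemma E_mat_carrier:
  "i \<in> {1..n} \<Longrightarrow> E_mat n k i \<in> carrier_mat (\<Prod>j\<in>{1..n}. k j) (\<Prod>j\<in>{1..n} - {i}. k j)"
  by (simp only: E_mat_eq_fibre_mat fibre_mat_carrier)

lemma Lambda_mat_carrier:
  "Lambda_mat n k w i \<in> carrier_mat (\<Prod>j\<in>{1..n}. k j) (\<Prod>j\<in>{1..n}. k j)"
  unfolding Lambda_mat_def by (rule mat_diag_dim)

lemma pure_block_carrier:
  assumes "i \<in> {1..n}"
  shows "pure_block n k w i \<in> carrier_mat (\<Prod>j\<in>{1..n}. k j) (\<Prod>j\<in>{1..n}. k j)"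
proof -
  note E = E_mat_carrier[OF assms, of k]
  have "Lambda_mat n k w i * E_mat n k i * (E_mat n k i)\<^sup>T \<in> carrier_mat (\<Prod>j\<in>{1..n}. k j) (\<Prod>j\<in>{1..n}. k j)"
    using mult_carrier_mat[OF mult_carrier_mat[OF Lambda_mat_carrier E]] E
    by (simp only: transpose_carrier_mat)
  thus ?thesis unfolding pure_block_def by (rule minus_carrier_mat[OF smult_carrier_mat])
qed

text \<open>Each fibre of \<open>coset_pos\<close> has \<open>k i\<close> elements, so the bracket
  is the deviation of the potential \<open>x\<close> from its mean over the strategies of player
  \<open>i\<close>.\<close>

lemma pure_block_mult_vec:
  assumes i: "i \<in> {1..n}" and x: "x \<in> carrier_vec (\<Prod>j\<in>{1..n}. k j)" and p: "p < (\<Prod>j\<in>{1..n}. k j)"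
  shows "(pure_block n k w i *\<^sub>v x) $ p = structure_vec k ({1..n} - {i}) (w i) $ coset_pos n k i p *
    (x $ p - 1 / real (k i) *
      (\<Sum>p' | p' < (\<Prod>j\<in>{1..n}. k j) \<and> coset_pos n k i p' = coset_pos n k i p. x $ p'))"
  unfolding pure_block_def Lambda_mat_def E_mat_eq_fibre_mat[OF i]
  by (rule weighted_deviation_mult_vec[OF coset_pos_less[OF i] structure_vec_carrier x p]) auto

lemma pure_block_orthogonal_E_mat:
  assumes i: "i \<in> {1..n}" and x: "x \<in> carrier_vec (\<Prod>j\<in>{1..n}. k j)"
    and y: "y \<in> carrier_vec (\<Prod>j\<in>{1..n} - {i}. k j)"
  shows "(pure_block n k w i *\<^sub>v x) \<bullet> (E_mat n k i *\<^sub>v y) = 0"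
  unfolding E_mat_eq_fibre_mat[OF i]
  by (rule weighted_deviation_orthogonal[OF coset_pos_less[OF i] structure_vec_carrier x y
        card_coset_pos_fibre[OF i] mult_mat_vec_carrier[OF pure_block_carrier[OF i] x]
        pure_block_mult_vec[OF i x]]) auto

lemma length_players: "length [1..<n + 1] = n"
  by simp

lemma set_players: "set [1..<n + 1] = {1..n}"
  by auto

lemma B_cw_P_carrier: "B_cw_P n k w \<in> carrier_mat (game_dim n k) (\<Prod>j\<in>{1..n}. k j)"
proof -
  have "\<forall>i\<in>set [1..<n + 1]. pure_block n k w i \<in> carrier_mat (\<Prod>j\<in>{1..n}. k j) (\<Prod>j\<in>{1..n}. k j)"
    unfolding set_players by (intro ballI pure_block_carrier)
  from foldr_append_rows_carrier[OF this] show ?thesis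
    unfolding B_cw_P_def game_dim_def length_players pure_block_def .
qed

lemma E_mat_carrier_players:
  "\<forall>i\<in>set [1..<n + 1]. E_mat n k i \<in> carrier_mat (\<Prod>j\<in>{1..n}. k j) (\<Prod>j\<in>{1..n} - {i}. k j)"
  unfolding set_players by (intro ballI E_mat_carrier)

lemma B_N_carrier:
  "B_N n k \<in> carrier_mat (game_dim n k) (\<Sum>i\<leftarrow>[1..<n + 1]. \<Prod>j\<in>{1..n} - {i}. k j)"
  using diag_block_mat_carrier[OF E_mat_carrier_players]
  unfolding B_N_def game_dim_def length_players .

abbreviation player_blocks :: "nat \<Rightarrow> (nat \<Rightarrow> real vec) \<Rightarrow> real vec" where
  "player_blocks n f \<equiv> foldr (@\<^sub>v) (map f [1..<n + 1]) vNil"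

lemma player_blocks_cong:
  "(\<And>i. i \<in> {1..n} \<Longrightarrow> f i = g i) \<Longrightarrow> player_blocks n f = player_blocks n g"
  by (metis map_cong set_players)

text \<open>Vertical stacking feeds the same \<open>x\<close> to every block: all players share one
  potential.\<close>

lemma pure_potential_games_eq:
  "pure_potential_games n k w =
     {player_blocks n (\<lambda>i. pure_block n k w i *\<^sub>v x) | x. x \<in> carrier_vec (\<Prod>j\<in>{1..n}. k j)}"
proof -
  have "B_cw_P n k w *\<^sub>v x = player_blocks n (\<lambda>i. pure_block n k w i *\<^sub>v x)"
    if "x \<in> carrier_vec (\<Prod>j\<in>{1..n}. k j)" for x
    using foldr_append_rows_mult_vec[of "[1..<n + 1]" "pure_block n k w", OF _ that] pure_block_carrier
    unfolding B_cw_P_def set_players pure_block_def by blast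
  thus ?thesis
    using B_cw_P_carrier[of n k w] mult_mat_vec_carrier[OF B_cw_P_carrier[of n k w]]
    unfolding pure_potential_games_def vec_space.col_space_eq[OF B_cw_P_carrier]
    by (auto simp only: carrier_matD)
qed

text \<open>In contrast to the stacked matrix, the block diagonal one allows each player an
  independent vector \<open>y i\<close>.\<close>

lemma nonstrategic_games_eq:
  "nonstrategic_games n k =
     {player_blocks n (\<lambda>i. E_mat n k i *\<^sub>v y i) | y. \<forall>i\<in>{1..n}. y i \<in> carrier_vec (\<Prod>j\<in>{1..n} - {i}. k j)}"
    (is "?A = ?B")
proof
  let ?l = "\<lambda>i. \<Prod>j\<in>{1..n} - {i}. k j"
  have A: "?A = {u \<in> carrier_vec (game_dim n k). \<exists>y\<in>carrier_vec (\<Sum>i\<leftarrow>[1..<n + 1]. ?l i). B_N n k *\<^sub>v y = u}"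
    unfolding nonstrategic_games_def vec_space.col_space_eq[OF B_N_carrier]
    by (simp only: carrier_matD[OF B_N_carrier])
  note E = E_mat_carrier_players[of n k]
  show "?A \<subseteq> ?B"
  proof
    fix u assume "u \<in> ?A"
    then obtain y where y: "y \<in> carrier_vec (\<Sum>i\<leftarrow>[1..<n + 1]. ?l i)" "u = B_N n k *\<^sub>v y"
      unfolding A by blast
    show "u \<in> ?B"
      using diag_block_mat_mult_vec_eq_foldr[OF E distinct_upt y(1)]
      unfolding y(2) B_N_def set_players by blast
  qed
  show "?B \<subseteq> ?A"
  proof
    fix u assume "u \<in> ?B"
    then obtain y where y: "\<forall>i\<in>set [1..<n + 1]. y i \<in> carrier_vec (?l i)"
      and u: "u = player_blocks n (\<lambda>i. E_mat n k i *\<^sub>v y i)"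
      unfolding set_players by blast
    obtain z where "z \<in> carrier_vec (\<Sum>i\<leftarrow>[1..<n + 1]. ?l i)" "B_N n k *\<^sub>v z = u"
      using foldr_eq_diag_block_mat_mult_vec[of "[1..<n + 1]" "E_mat n k" _ ?l y] E y
      unfolding B_N_def u by blast
    thus "u \<in> ?A" using mult_mat_vec_carrier[OF B_N_carrier, of z] unfolding A by blast
  qed
qed

text \<open>The inner product splits into one summand per player, and each vanishes by the fibrewise
  argument, whatever \<open>x\<close> and \<open>y i\<close> are.\<close>

lemma pure_potential_orthogonal_nonstrategic:
  assumes "u \<in> pure_potential_games n k w" "v \<in> nonstrategic_games n k"
  shows "u \<bullet> v = 0"
proof -
  obtain x y where x: "x \<in> carrier_vec (\<Prod>j\<in>{1..n}. k j)"
    and y: "\<forall>i\<in>{1..n}. y i \<in> carrier_vec (\<Prod>j\<in>{1..n} - {i}. k j)"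
    and u: "u = player_blocks n (\<lambda>i. pure_block n k w i *\<^sub>v x)"
    and v: "v = player_blocks n (\<lambda>i. E_mat n k i *\<^sub>v y i)"
    using assms unfolding pure_potential_games_eq nonstrategic_games_eq by blast
  have "u \<bullet> v = (\<Sum>i\<leftarrow>[1..<n + 1]. (pure_block n k w i *\<^sub>v x) \<bullet> (E_mat n k i *\<^sub>v y i))"
    unfolding u v
    by (rule foldr_append_vec_scalar_prod, unfold set_players)
      (use mult_mat_vec_carrier[OF pure_block_carrier x] mult_mat_vec_carrier[OF E_mat_carrier] y in blast)
  also have "\<dots> = (\<Sum>i\<leftarrow>[1..<n + 1]. 0)"
    by (intro arg_cong[of _ _ sum_list] map_cong refl, unfold set_players)
      (use pure_block_orthogonal_E_mat[OF _ x] y in blast)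
  finally show ?thesis by simp
qed

section \<open>Potential games as sums of pure potential and non-strategic games\<close>

lemma profile_upd:
  assumes "i \<in> J" "s \<in> profiles k (J - {i})" "a \<in> {1..k i}"
  shows "s(i := a) \<in> profiles k J"
  using assms by (auto simp: profiles_def PiE_iff extensional_def)

lemma profile_pos_upd:
  assumes "finite J" shows "profile_pos k (J - {i}) (s(i := a)) = profile_pos k (J - {i}) s"
  unfolding profile_pos_def by (rule profile_index_cong) (use assms in auto)

text \<open>Translates a common fibre back into game terms: two profiles that agree off player
  \<open>i\<close>, in the form \<open>s(i := a)\<close> and \<open>s(i := b)\<close> to which the
  potential equation applies.\<close>

lemma coset_pos_eqE:
  assumes i: "i \<in> {1..n}" and p: "p < (\<Prod>j\<in>{1..n}. k j)" "p' < (\<Prod>j\<in>{1..n}. k j)"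
    and eq: "coset_pos n k i p = coset_pos n k i p'"
  obtains s a b where "s \<in> profiles k ({1..n} - {i})" "a \<in> {1..k i}" "b \<in> {1..k i}"
    "p = profile_pos k {1..n} (s(i := a))" "p' = profile_pos k {1..n} (s(i := b))"
    "coset_pos n k i p = profile_pos k ({1..n} - {i}) s"
proof -
  obtain t t' where t: "t \<in> profiles k {1..n}" "profile_pos k {1..n} t = p"
    and t': "t' \<in> profiles k {1..n}" "profile_pos k {1..n} t' = p'"
    using profile_pos_surj[of "{1..n}"] p by (metis finite_atLeastAtMost)
  \<comment> \<open>Restriction yields the extensional partial profile of the other players, and
    updating it with \<open>u i\<close> restores \<open>u\<close>.\<close>
  define r where "r u = restrict u ({1..n} - {i})" for u :: "nat \<Rightarrow> nat"
  have r: "r u \<in> profiles k ({1..n} - {i})" "(r u)(i := u i) = u"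
    "profile_pos k ({1..n} - {i}) (r u) = coset_pos n k i (profile_pos k {1..n} u)"
    if u: "u \<in> profiles k {1..n}" for u
  proof -
    show "r u \<in> profiles k ({1..n} - {i})" using u by (auto simp: r_def profiles_def PiE_iff)
    show "(r u)(i := u i) = u"
      using u i by (auto simp: r_def profiles_def PiE_iff extensional_def fun_eq_iff)
    thus "profile_pos k ({1..n} - {i}) (r u) = coset_pos n k i (profile_pos k {1..n} u)"
      using coset_pos_profile_pos[OF i u] profile_pos_upd[of "{1..n}" k i "r u" "u i"] by simp
  qed
  have "profile_pos k ({1..n} - {i}) (r t) = profile_pos k ({1..n} - {i}) (r t')"
    using r(3)[OF t(1)] r(3)[OF t'(1)] t t' eq by simp
  hence "r t = r t'" by (intro profile_pos_inj[OF _ r(1)[OF t(1)] r(1)[OF t'(1)]]) auto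
  show thesis
  proof (rule that)
    show "r t \<in> profiles k ({1..n} - {i})" by (rule r(1)[OF t(1)])
    show "t i \<in> {1..k i}" "t' i \<in> {1..k i}" using profiles_mem t t' i by metis+
    show "p = profile_pos k {1..n} ((r t)(i := t i))" using r(2) t by simp
    show "p' = profile_pos k {1..n} ((r t)(i := t' i))" using r(2) t' \<open>r t = r t'\<close> by simp
    show "coset_pos n k i p = profile_pos k ({1..n} - {i}) (r t)" using r(3) t by simp
  qed
qed

text \<open>Fibre means cancel in differences along a fibre, so the weighted deviation of a function
  has the same weighted differences as the function itself. A game with potential \<open>P\<close>
  thus differs from the pure game of \<open>P\<close> by something constant on fibres, and adding
  such a term preserves the potential.\<close>

lemma potential_games_eq:
  "potential_games n k w =
     {u + v | u v. u \<in> pure_potential_games n k w \<and> v \<in> nonstrategic_games n k}"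
    (is "?G = ?S")
proof
  let ?K = "\<Prod>j\<in>{1..n}. k j" and ?l = "\<lambda>i. \<Prod>j\<in>{1..n} - {i}. k j"
  note Mc = mult_mat_vec_carrier[OF pure_block_carrier]
  note Ec = mult_mat_vec_carrier[OF E_mat_carrier]
  note sv = structure_vec_index[OF finite_atLeastAtMost]
  note svc = structure_vec_carrier[OF finite_atLeastAtMost]
  have add: "player_blocks n (\<lambda>i. pure_block n k w i *\<^sub>v x) + player_blocks n (\<lambda>i. E_mat n k i *\<^sub>v y i)
      = player_blocks n (\<lambda>i. pure_block n k w i *\<^sub>v x + E_mat n k i *\<^sub>v y i)"
    if "x \<in> carrier_vec ?K" "\<forall>i\<in>{1..n}. y i \<in> carrier_vec (?l i)" for x y
    by (rule foldr_append_vec_add, unfold set_players) (use Mc Ec that in blast)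
  show "?G \<subseteq> ?S"
  proof
    fix g assume "g \<in> ?G"
    then obtain c P where g: "g = game_vec n k c" and P: "is_weighted_potential n k w c P"
      unfolding potential_games_def by blast
    define x where "x = structure_vec k {1..n} P"
    have x: "x \<in> carrier_vec ?K" unfolding x_def by (rule svc)
    have "\<exists>y\<in>carrier_vec (?l i).
        E_mat n k i *\<^sub>v y = structure_vec k {1..n} (c i) - pure_block n k w i *\<^sub>v x"
      if i: "i \<in> {1..n}" for i
      unfolding E_mat_eq_fibre_mat[OF i]
    proof (rule constant_on_fibres_in_range[OF coset_pos_less[OF i]])
      show "structure_vec k {1..n} (c i) - pure_block n k w i *\<^sub>v x \<in> carrier_vec ?K"
        using svc Mc[OF i x] by (rule minus_carrier_vec)
      fix p p' assume p: "p < ?K" "p' < ?K" and eq: "coset_pos n k i p = coset_pos n k i p'"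
      obtain s a b where s: "s \<in> profiles k ({1..n} - {i})" "a \<in> {1..k i}" "b \<in> {1..k i}"
        "p = profile_pos k {1..n} (s(i := a))" "p' = profile_pos k {1..n} (s(i := b))"
        "coset_pos n k i p = profile_pos k ({1..n} - {i}) s"
        by (rule coset_pos_eqE[OF i p eq])
      note up = profile_upd[OF i s(1)]
      have "c i (s(i := a)) - c i (s(i := b)) = w i s * (P (s(i := a)) - P (s(i := b)))"
        using P i s unfolding is_weighted_potential_def by blast
      moreover have "structure_vec k ({1..n} - {i}) (w i) $ coset_pos n k i p = w i s"
        unfolding s(6) by (rule structure_vec_index) (use s in auto)
      \<comment> \<open>The potential equation at positions: payoff differences along the fibre are
        the fibre weight times differences of \<open>x\<close>.\<close>
      ultimately have "structure_vec k {1..n} (c i) $ p - structure_vec k {1..n} (c i) $ p'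
          = structure_vec k ({1..n} - {i}) (w i) $ coset_pos n k i p * (x $ p - x $ p')"
        unfolding x_def s(4,5) by (simp only: sv[OF up[OF s(2)]] sv[OF up[OF s(3)]])
      \<comment> \<open>Weight and fibre mean depend only on the common value of
        \<open>coset_pos\<close>, so the mean drops out and the two differences cancel.\<close>
      thus "(structure_vec k {1..n} (c i) - pure_block n k w i *\<^sub>v x) $ p
          = (structure_vec k {1..n} (c i) - pure_block n k w i *\<^sub>v x) $ p'"
        using pure_block_mult_vec[OF i x p(1), of w] pure_block_mult_vec[OF i x p(2), of w] p
          carrier_vecD[OF Mc[OF i x, of w]] eq
        by (simp add: algebra_simps)
    qed (use that in auto)
    then obtain y where y: "\<forall>i\<in>{1..n}. y i \<in> carrier_vec (?l i)"
      and Ey: "\<And>i. i \<in> {1..n} \<Longrightarrow> E_mat n k i *\<^sub>v y i = structure_vec k {1..n} (c i) - pure_block n k w i *\<^sub>v x"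
      by metis
    have "g = player_blocks n (\<lambda>i. pure_block n k w i *\<^sub>v x + E_mat n k i *\<^sub>v y i)"
      unfolding g game_vec_def
    proof (rule player_blocks_cong)
      fix i assume i: "i \<in> {1..n}"
      show "structure_vec k {1..n} (c i) = pure_block n k w i *\<^sub>v x + E_mat n k i *\<^sub>v y i"
      proof -
        have "a = b + (a - b)" if "a \<in> carrier_vec m" "b \<in> carrier_vec m" for a b :: "real vec" and m
          using that by (intro eq_vecI) auto
        thus ?thesis unfolding Ey[OF i] using svc Mc[OF i x] by blast
      qed
    qed
    thus "g \<in> ?S"
      unfolding pure_potential_games_eq nonstrategic_games_eq using add[OF x y, symmetric] x y by blast
  qed
  show "?S \<subseteq> ?G"
  proof
    fix g assume "g \<in> ?S"
    then obtain x y where x: "x \<in> carrier_vec ?K" and y: "\<forall>i\<in>{1..n}. y i \<in> carrier_vec (?l i)"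
      and g: "g = player_blocks n (\<lambda>i. pure_block n k w i *\<^sub>v x + E_mat n k i *\<^sub>v y i)"
      unfolding pure_potential_games_eq nonstrategic_games_eq using add by blast
    let ?v = "\<lambda>i. pure_block n k w i *\<^sub>v x + E_mat n k i *\<^sub>v y i"
    \<comment> \<open>The payoffs are read off the blocks, and the common vector \<open>x\<close> is
      itself the table of a potential.\<close>
    define c where "c i s = ?v i $ profile_pos k {1..n} s" for i s
    define P where "P s = x $ profile_pos k {1..n} s" for s
    have "g = game_vec n k c"
      unfolding g game_vec_def
    proof (rule player_blocks_cong)
      fix i assume i: "i \<in> {1..n}"
      have "?v i \<in> carrier_vec ?K" by (rule add_carrier_vec[OF Mc[OF i x] Ec[OF i bspec[OF y i]]])
      thus "?v i = structure_vec k {1..n} (c i)"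
        unfolding c_def by (rule structure_vec_of_vec[OF finite_atLeastAtMost, symmetric])
    qed
    moreover have "is_weighted_potential n k w c P"
      unfolding is_weighted_potential_def
    proof (intro ballI)
      fix i a b s assume i: "i \<in> {1..n}" and ab: "a \<in> {1..k i}" "b \<in> {1..k i}"
        and s: "s \<in> profiles k ({1..n} - {i})"
      define p p' where "p = profile_pos k {1..n} (s(i := a))" and "p' = profile_pos k {1..n} (s(i := b))"
      have q: "coset_pos n k i p = profile_pos k ({1..n} - {i}) s"
        "coset_pos n k i p' = profile_pos k ({1..n} - {i}) s"
        unfolding p_def p'_def using coset_pos_profile_pos[OF i profile_upd[OF i s]] ab
          profile_pos_upd[of "{1..n}" k i s] by auto
      have p: "p < ?K" "p' < ?K"
        unfolding p_def p'_def using profile_pos_less[OF _ profile_upd[OF i s]] ab by auto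
      have w: "structure_vec k ({1..n} - {i}) (w i) $ profile_pos k ({1..n} - {i}) s = w i s"
        by (rule structure_vec_index) (use s in auto)
      have yi: "y i \<in> carrier_vec (?l i)" using y i by blast
      \<comment> \<open>The non-strategic part takes equal values at \<open>p\<close> and
        \<open>p'\<close>, so it disappears from the payoff difference.\<close>
      have "(E_mat n k i *\<^sub>v y i) $ p = (E_mat n k i *\<^sub>v y i) $ p'"
        unfolding E_mat_eq_fibre_mat[OF i]
        using fibre_mat_mult_vec[of "coset_pos n k i", OF coset_pos_less[OF i p(1)] p(1) yi]
          fibre_mat_mult_vec[of "coset_pos n k i", OF coset_pos_less[OF i p(2)] p(2) yi] q by simp
      thus "c i (s(i := a)) - c i (s(i := b)) = w i s * (P (s(i := a)) - P (s(i := b)))"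
        unfolding c_def P_def p_def[symmetric] p'_def[symmetric]
        using pure_block_mult_vec[OF i x p(1), of w] pure_block_mult_vec[OF i x p(2), of w] p q w
          carrier_vecD[OF Mc[OF i x, of w]] carrier_vecD[OF Ec[OF i yi]]
        by (simp add: algebra_simps)
    qed
    ultimately show "g \<in> ?G" unfolding potential_games_def by blast
  qed
qed

section \<open>Orthogonal decomposition of the space of games\<close>

theorem mainTheorem6:
  fixes n :: nat
    and k :: "nat \<Rightarrow> nat"
    and w :: "nat \<Rightarrow> (nat \<Rightarrow> nat) \<Rightarrow> real"
  assumes "n \<ge> 2"
    and "\<And>i. i \<in> {1..n} \<Longrightarrow> k i \<ge> 2"
    and "\<And>i s. i \<in> {1..n} \<Longrightarrow> s \<in> profiles k ({1..n} - {i}) \<Longrightarrow> w i s > 0"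
  shows "is_direct_sum (game_dim n k)
           [pure_potential_games n k w, nonstrategic_games n k, pure_harmonic_games n k w]
           (carrier_vec (game_dim n k))
       \<and> pairwise_orthogonal
           [pure_potential_games n k w, nonstrategic_games n k, pure_harmonic_games n k w]
       \<and> is_direct_sum (game_dim n k)
           [pure_potential_games n k w, nonstrategic_games n k] (potential_games n k w)
       \<and> is_direct_sum (game_dim n k)
           [nonstrategic_games n k, pure_harmonic_games n k w] (harmonic_games n k w)"
proof -
  let ?d = "game_dim n k"
  let ?P = "pure_potential_games n k w" and ?N = "nonstrategic_games n k"
  let ?H = "pure_harmonic_games n k w" and ?G = "potential_games n k w"
  let ?sub = "\<lambda>U. subspace class_ring U (module_vec TYPE(real) ?d)"
  let ?sum = "\<lambda>vs. foldr (+) vs (0\<^sub>v ?d)"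
  have sP: "?sub ?P" unfolding pure_potential_games_def by (rule subspace_col_space[OF B_cw_P_carrier])
  have sN: "?sub ?N" unfolding nonstrategic_games_def by (rule subspace_col_space[OF B_N_carrier])
  note cP = subspace_vecD(1)[OF sP] and cN = subspace_vecD(1)[OF sN]
  have G: "?G \<subseteq> carrier_vec ?d"
    unfolding potential_games_eq using cP cN by (auto intro!: add_carrier_vec)
  have sH: "?sub ?H" unfolding pure_harmonic_games_def by (rule subspace_orthogonal_complement[OF G])
  note cH = subspace_vecD(1)[OF sH]
  \<comment> \<open>Orthogonality to the sum means orthogonality to both summands: each lies in the
    sum, with the zero vector taken from the other, and the converse is additivity.\<close>
  have H: "v \<in> ?H \<longleftrightarrow> v \<in> carrier_vec ?d \<and> (\<forall>p\<in>?P. v \<bullet> p = 0) \<and> (\<forall>q\<in>?N. v \<bullet> q = 0)" for v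
  proof -
    have "(\<forall>g\<in>?G. v \<bullet> g = 0) \<longleftrightarrow> (\<forall>p\<in>?P. v \<bullet> p = 0) \<and> (\<forall>q\<in>?N. v \<bullet> q = 0)"
      if v: "v \<in> carrier_vec ?d"
    proof (intro iffI conjI ballI)
      fix p assume "\<forall>g\<in>?G. v \<bullet> g = 0" and p: "p \<in> ?P"
      moreover have "p + 0\<^sub>v ?d \<in> ?G" unfolding potential_games_eq using p subspace_vecD(2)[OF sN] by blast
      moreover have "p + 0\<^sub>v ?d = p" using p cP by (intro right_zero_vec) blast
      ultimately show "v \<bullet> p = 0" by metis
    next
      fix q assume "\<forall>g\<in>?G. v \<bullet> g = 0" and q: "q \<in> ?N"
      moreover have "0\<^sub>v ?d + q \<in> ?G" unfolding potential_games_eq using q subspace_vecD(2)[OF sP] by blast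
      moreover have "0\<^sub>v ?d + q = q" using q cN by (intro left_zero_vec) blast
      ultimately show "v \<bullet> q = 0" by metis
    next
      fix g assume z: "(\<forall>p\<in>?P. v \<bullet> p = 0) \<and> (\<forall>q\<in>?N. v \<bullet> q = 0)" and "g \<in> ?G"
      then obtain p q where pq: "p \<in> ?P" "q \<in> ?N" "g = p + q" unfolding potential_games_eq by blast
      have "v \<bullet> g = v \<bullet> p + v \<bullet> q"
        unfolding pq(3) using v pq cP cN by (intro scalar_prod_add_distrib[of _ ?d]) auto
      thus "v \<bullet> g = 0" using z pq by simp
    qed
    thus ?thesis unfolding pure_harmonic_games_def vec_module.orthogonal_complement_def by blast
  qed
  have oPN: "u \<bullet> v = 0" if "u \<in> ?P" "v \<in> ?N" for u v
    using that by (rule pure_potential_orthogonal_nonstrategic)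
  have oPH: "u \<bullet> v = 0" if "u \<in> ?P" "v \<in> ?H" for u v
    using that H[of v] comm_scalar_prod[of u ?d v] cP by auto
  have oNH: "u \<bullet> v = 0" if "u \<in> ?N" "v \<in> ?H" for u v
    using that H[of v] comm_scalar_prod[of u ?d v] cN by auto
  have orth: "pairwise_orthogonal [?P, ?N, ?H]"
    unfolding pairwise_orthogonal_def using oPN oPH oNH by simp
  have "pairwise_orthogonal [?P, ?N]" "pairwise_orthogonal [?N, ?H]"
    using orth unfolding pairwise_orthogonal_def by simp_all
  \<comment> \<open>The fold ends by adding \<open>0\<^sub>v\<close>, which disappears because the
    last summand has the right dimension.\<close>
  have ls2: "?sum ` listset [U, W] = {u + v |u v. u \<in> U \<and> v \<in> W}" if "W \<subseteq> carrier_vec ?d" for U W :: "real vec set"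
  proof -
    have img: "f ` {g u v |u v. R u v} = {f (g u v) |u v. R u v}"
      for f :: "real vec list \<Rightarrow> real vec" and g :: "real vec \<Rightarrow> real vec \<Rightarrow> real vec list" and R
      by blast
    have "listset [U, W] = {[u, v] |u v. u \<in> U \<and> v \<in> W}" by (auto simp: set_Cons_def)
    hence "?sum ` listset [U, W] = {?sum [u, v] |u v. u \<in> U \<and> v \<in> W}"
      by (simp only: img)
    moreover have e: "?sum [u, v] = u + v" if "v \<in> W" for u v
      using right_zero_vec[of v ?d] that \<open>W \<subseteq> _\<close> by auto
    have "{?sum [u, v] |u v. u \<in> U \<and> v \<in> W} = {u + v |u v. u \<in> U \<and> v \<in> W}"
      by (intro Collect_cong) (metis e)
    ultimately show ?thesis by (rule trans)
  qed
  have sum: "?sum ` listset [?P, ?N, ?H] = carrier_vec ?d"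
  proof (intro equalityI subsetI)
    fix u assume "u \<in> ?sum ` listset [?P, ?N, ?H]"
    thus "u \<in> carrier_vec ?d" using foldr_add_listset_carrier[of "[?P, ?N, ?H]" ?d] cP cN cH by auto
  next
    fix u :: "real vec" assume u: "u \<in> carrier_vec ?d"
    obtain p where p: "p \<in> ?P" "\<forall>v\<in>?P. (u - p) \<bullet> v = 0"
      using ex_projection_col_space[OF B_cw_P_carrier u] unfolding pure_potential_games_def by blast
    obtain q where q: "q \<in> ?N" "\<forall>v\<in>?N. (u - q) \<bullet> v = 0"
      using ex_projection_col_space[OF B_N_carrier u] unfolding nonstrategic_games_def by blast
    have c: "p \<in> carrier_vec ?d" "q \<in> carrier_vec ?d" using p q cP cN by auto
    \<comment> \<open>\<open>p\<close> and \<open>q\<close> are separate projections of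
      \<open>u\<close>. Since the two subspaces are orthogonal, subtracting \<open>q\<close> does
      not spoil orthogonality of \<open>u - p\<close> to the first, nor subtracting \<open>p\<close>
      that of \<open>u - q\<close> to the second.\<close>
    define h where "h = u - p - q"
    have hc: "h \<in> carrier_vec ?d" using u c by (simp add: h_def)
    have "h \<bullet> v = 0" if v: "v \<in> ?P" for v
    proof -
      have vc: "v \<in> carrier_vec ?d" using v cP by blast
      have "h \<bullet> v = (u - p) \<bullet> v - q \<bullet> v"
        unfolding h_def using u c vc by (intro minus_scalar_prod_distrib[of _ ?d]) auto
      moreover have "q \<bullet> v = 0" using oPN[OF v q(1)] comm_scalar_prod[OF vc c(2)] by simp
      ultimately show ?thesis using p(2) v by simp
    qed
    moreover have "h \<bullet> v = 0" if v: "v \<in> ?N" for v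
    proof -
      have vc: "v \<in> carrier_vec ?d" using v cN by blast
      \<comment> \<open>The subtractions are swapped so that the residual of the projection onto the
        non-strategic games appears.\<close>
      have "h = u - q - p" unfolding h_def using u c by (intro eq_vecI) auto
      hence "h \<bullet> v = (u - q) \<bullet> v - p \<bullet> v"
        using u c vc by (auto intro!: minus_scalar_prod_distrib[of _ ?d])
      thus ?thesis using q(2) v oPN[OF p(1) v] by simp
    qed
    ultimately have "h \<in> ?H" unfolding H using hc by blast
    hence "[p, q, h] \<in> listset [?P, ?N, ?H]" using p q by (simp add: set_Cons_def)
    moreover have "u = ?sum [p, q, h]" unfolding h_def using u c by (intro eq_vecI) auto
    ultimately show "u \<in> ?sum ` listset [?P, ?N, ?H]" by blast
  qed
  have "is_direct_sum ?d [?P, ?N, ?H] (carrier_vec ?d)"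
    by (rule is_direct_sum_orthogonal[OF _ orth sum]) (use sP sN sH in auto)
  moreover have "is_direct_sum ?d [?P, ?N] ?G"
    using sP sN ls2[OF cN, of ?P] \<open>pairwise_orthogonal [?P, ?N]\<close>
    by (intro is_direct_sum_orthogonal) (auto simp only: potential_games_eq list.set)
  moreover have "harmonic_games n k w = {u + v |u v. u \<in> ?N \<and> v \<in> ?H}"
    unfolding harmonic_games_def module.submodule_sum_def[OF vec_module] by (auto simp: module_vec_simps)
  hence "is_direct_sum ?d [?N, ?H] (harmonic_games n k w)"
    using sN sH ls2[OF cH, of ?N] \<open>pairwise_orthogonal [?N, ?H]\<close>
    by (intro is_direct_sum_orthogonal) (auto simp only: list.set)
  ultimately show ?thesis using orth by blast
qed

end
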